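(* Let $X$ and $Y$ be the limit random variables (defined in the context) of the continuous-time urn process started from one red ball and from one black ball respectively, and let $\mathcal{F}(x)=\mathbb{E}(e^{ixX})$ and $\mathcal{G}(x)=\mathbb{E}(e^{ixY})$, $x\in\mathbb{R}$, be their characteristic functions. Then $\mathcal{F}$ and $\mathcal{G}$ are solutions on $\mathbb{R}$ of the differential system $$\begin{cases}\mathcal{F}(x)+mx\,\mathcal{F}'(x)=\mathcal{F}(x)^{a+1}\mathcal{G}(x)^{b},\\ \mathcal{G}(x)+mx\,\mathcal{G}'(x)=\mathcal{F}(x)^{c}\mathcal{G}(x)^{d+1},\end{cases}$$ and satisfy, as $x\to 0$, the boundary conditions $$\begin{cases}\mathcal{F}(x)=1+i\dfrac{b}{S}x+O(x^2),\\ \mathcal{G}(x)=1-i\dfrac{c}{S}x+O(x^2).\end{cases}$$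
   Context: Standing assumptions (balanced, large, nontriangular urn): $m,S,b$ are integers with $m+2\le S\le 2m-1$ and $1\le b\le S-m-1$; put $a=S-b$, $c=S-m-b$, $d=m+b$. The replacement matrix is $\begin{pmatrix}a&b\\ c&d\end{pmatrix}$, with $a+b=c+d=S$ and eigenvalues $S$ and $m$. For $(\alpha,\beta)\in\mathbb{N}^2\setminus\{(0,0)\}$, $(U^{CT}_{(\alpha,\beta)}(t))_{t\ge0}$ is the Markov jump process on $\mathbb{N}^2\setminus\{(0,0)\}$ started at $(\alpha,\beta)$ which, from a state $(x,y)$ ($x$ red balls, $y$ black balls), jumps to $(x+a,y+b)$ at rate $x$ and to $(x+c,y+d)$ at rate $y$. Let $u_2(x,y)=\frac1S(bx-cy)$. Then $$X=\lim_{t\to+\infty}e^{-mt}u_2(U^{CT}_{(1,0)}(t)),\qquad Y=\lim_{t\to+\infty}e^{-mt}u_2(U^{CT}_{(0,1)}(t)),$$ the limits existing almost surely and in every $L^p$, $p\ge1$. *)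

theory Defs
  imports "HOL-Probability.Probability" "HOL-Library.Landau_Symbols"
begin

definition exit_rate :: "'s set \<Rightarrow> ('s \<Rightarrow> 's \<Rightarrow> real) \<Rightarrow> 's \<Rightarrow> real" where
  "exit_rate E r z = (\<Sum>\<^sub>\<infinity>v\<in>E. r z v)"

text \<open>
  A Markov jump process on the countable state space \<open>E\<close>, started at \<open>z0\<close>, that jumps from \<open>z\<close>
  to \<open>v\<close> at rate \<open>r z v\<close>; rates are meant to satisfy \<open>r z z = 0\<close> and to have a positive finite
  exit rate at every state of \<open>E\<close>. This is the jump chain / holding time description:
  \<open>Z\<close> is the sequence of visited states and \<open>T k\<close> is the time spent in \<open>Z k\<close>. The product formula
  says that \<open>Z\<close> is a Markov chain started at \<open>z0\<close> with transition probabilities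
  \<open>r z v / exit_rate E r z\<close> and that, given \<open>Z\<close>, the \<open>T k\<close> are independent and exponential with
  parameters \<open>exit_rate E r (Z k)\<close>. The process sits in \<open>Z n\<close> from the time of the \<open>n\<close>-th jump
  (inclusive) up to the next one (exclusive). Nothing is prescribed after an explosion.
\<close>
definition markov_jump_process ::
  "'w measure \<Rightarrow> 's set \<Rightarrow> ('s \<Rightarrow> 's \<Rightarrow> real) \<Rightarrow> 's \<Rightarrow> (real \<Rightarrow> 'w \<Rightarrow> 's) \<Rightarrow> bool" where
  "markov_jump_process M E r z0 U \<longleftrightarrow>
     prob_space M \<and> countable E \<and> z0 \<in> E \<and>
     (\<forall>t\<ge>0. U t \<in> M \<rightarrow>\<^sub>M count_space E) \<and>
     (\<exists>(Z :: nat \<Rightarrow> 'w \<Rightarrow> 's) (T :: nat \<Rightarrow> 'w \<Rightarrow> real).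
        (\<forall>n. Z n \<in> M \<rightarrow>\<^sub>M count_space E) \<and>
        (\<forall>n. T n \<in> borel_measurable M) \<and>
        (\<forall>n z s. (\<forall>k\<le>n. z k \<in> E) \<longrightarrow> (\<forall>k<n. 0 \<le> s k) \<longrightarrow>
           measure M {w \<in> space M. (\<forall>k\<le>n. Z k w = z k) \<and> (\<forall>k<n. s k < T k w)} =
             (if z 0 = z0 then 1 else 0) *
             (\<Prod>k<n. r (z k) (z (Suc k)) / exit_rate E r (z k) *
                     exp (- exit_rate E r (z k) * s k))) \<and>
        (AE w in M. \<forall>n t. (\<Sum>k<n. T k w) \<le> t \<and> t < (\<Sum>k<Suc n. T k w) \<longrightarrow> U t w = Z n w))"

text \<open>
  States are pairs (number of red balls, number of black balls). The two summands are the rates of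
  the two kinds of jumps; written as a sum so that they add up should both jumps lead to the same
  state.
\<close>
definition urn_states :: "(nat \<times> nat) set" where
  "urn_states = UNIV - {(0, 0)}"

definition urn_rate ::
  "nat \<Rightarrow> nat \<Rightarrow> nat \<Rightarrow> nat \<Rightarrow> nat \<times> nat \<Rightarrow> nat \<times> nat \<Rightarrow> real" where
  "urn_rate a b c d = (\<lambda>(x, y) v.
     (if v = (x + a, y + b) then real x else 0) + (if v = (x + c, y + d) then real y else 0))"

definition urn_CT ::
  "nat \<Rightarrow> nat \<Rightarrow> nat \<Rightarrow> nat \<Rightarrow> 'w measure \<Rightarrow> nat \<times> nat \<Rightarrow> (real \<Rightarrow> 'w \<Rightarrow> nat \<times> nat) \<Rightarrow> bool" where
  "urn_CT a b c d M z0 U \<longleftrightarrow> markov_jump_process M urn_states (urn_rate a b c d) z0 U"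

definition u2 :: "nat \<Rightarrow> nat \<Rightarrow> nat \<Rightarrow> nat \<times> nat \<Rightarrow> real" where
  "u2 S b c = (\<lambda>(x, y). 1 / real S * (real b * real x - real c * real y))"

text \<open>
  Only almost sure convergence is required: it determines the limit up to a null set.
\<close>
definition urn_limit ::
  "nat \<Rightarrow> nat \<Rightarrow> nat \<Rightarrow> nat \<Rightarrow> 'w measure \<Rightarrow> (real \<Rightarrow> 'w \<Rightarrow> nat \<times> nat) \<Rightarrow> ('w \<Rightarrow> real) \<Rightarrow> bool" where
  "urn_limit m S b c M U X \<longleftrightarrow>
     X \<in> borel_measurable M \<and>
     (AE w in M. ((\<lambda>t. exp (- real m * t) * u2 S b c (U t w)) \<longlongrightarrow> X w) at_top)"

text \<open>
  The parameters are integers, but the constraints \<open>m + 2 \<le> S \<le> 2 m - 1\<close> and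
  \<open>1 \<le> b \<le> S - m - 1\<close> force \<open>m\<close>, \<open>S\<close>, \<open>b\<close>, \<open>a\<close>, \<open>c\<close>, \<open>d\<close> all to be positive, so natural numbers
  lose nothing; none of the subtractions truncates when the constraints hold, and the truncated
  constraints admit no further solutions.
\<close>
definition large_urn ::
  "nat \<Rightarrow> nat \<Rightarrow> nat \<Rightarrow> nat \<Rightarrow> nat \<Rightarrow> nat \<Rightarrow> bool" where
  "large_urn m S a b c d \<longleftrightarrow>
     m + 2 \<le> S \<and> S \<le> 2 * m - 1 \<and> 1 \<le> b \<and> b \<le> S - m - 1 \<and>
     a = S - b \<and> c = S - m - b \<and> d = m + b"

end

theory Submission
  imports Defs
begin

text \<open>
  The urn is balanced, so its total jump rate after \<open>k\<close> jumps is \<open>l + k * S\<close>, where \<open>l\<close> is the initial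
  number of balls, whatever colours were drawn. Hence the number of jumps up to time \<open>t\<close> is
  independent of the jump chain and negative binomial (\<open>yule_counting_law\<close>), and for bounded \<open>h\<close> the expectation of
  \<open>h (U t)\<close> is \<open>exp (- l * t)\<close> times a power series in \<open>1 - exp (- S * t)\<close> whose coefficients are, up to
  factorials and powers of \<open>S\<close>, the iterates of the operator \<open>(step h) (x, y) = x * h (x + a, y + b) + y * h (x + c, y + d)\<close>
  (\<open>expectation_eq_flow\<close>).

  All structure of the process is now read off this series. The operator obeys Leibniz' rule on
  multiplicative functions \<open>h (z + z') = h z * h z'\<close>, so the series is multiplicative in the initial state, which is
  the branching property (\<open>flow_branching\<close>). Termwise differentiation gives the backward equation
  (\<open>flow_backward_equation\<close>). For \<open>h = exp (\<i> * \<theta> * u2)\<close> the two together say that the characteristic functions \<open>f\<close>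
  and \<open>g\<close> of \<open>u2 (U t)\<close> from one red and from one black ball satisfy
  \<open>f' = - f + f ^ (a + 1) * g ^ b\<close> and \<open>g' = - g + f ^ c * g ^ (d + 1)\<close>.

  With the frequency \<open>\<theta> = x * exp (- m * t)\<close> and \<open>t \<rightarrow> \<infinity>\<close>, \<open>f\<close> and \<open>g\<close> converge to \<open>F x\<close> and \<open>G x\<close>
  (\<open>flow_tendsto_char\<close>). The backward equation, integrated over a window of length \<open>s\<close>, becomes
  \<open>F x = exp (- s) * F (x * exp (- m * s)) + \<integral> exp (- r) * H (x * exp (- m * r)) dr\<close> over \<open>0 \<le> r \<le> s\<close>, where
  \<open>H = F ^ (a + 1) * G ^ b\<close>, and likewise for \<open>G\<close> (\<open>limit_integral_equation\<close>). The right-hand side can be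
  differentiated in \<open>s\<close>, and for \<open>x \<noteq> 0\<close> this is the differential system (\<open>ode_of_integral_equation\<close>).

  The behaviour at \<open>0\<close> comes from two moments. The function \<open>u2\<close> is an eigenfunction of the generator with eigenvalue \<open>m\<close>,
  and because \<open>S < 2 * m\<close> its second moment grows at most like \<open>exp (2 * m * t)\<close>. So the Taylor expansion of
  \<open>f\<close> in \<open>x\<close> has a quadratic error that is uniform in \<open>t\<close> (\<open>flow_wave_taylor\<close>) and survives in the
  limit. This yields the boundary conditions and also differentiability at \<open>0\<close>.
\<close>

section \<open>Counting jumps with linearly growing rates\<close>

text \<open>
  The probability that a pure birth process with birth rates \<open>l + \<sigma> * k\<close>, \<open>k = 0, 1, 2, \<dots>\<close>, has
  made exactly \<open>n\<close> births at time \<open>t\<close>: a negative binomial law with real index \<open>l / \<sigma>\<close> and success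
  probability \<open>exp (- \<sigma> * t)\<close>.
\<close>
definition yule_pmf :: "real \<Rightarrow> real \<Rightarrow> nat \<Rightarrow> real \<Rightarrow> real" where
  "yule_pmf l \<sigma> n t = exp (- l * t) * (pochhammer (l / \<sigma>) n / fact n) * (1 - exp (- \<sigma> * t)) ^ n"

lemma yule_pmf_nonneg: "0 < l \<Longrightarrow> 0 < \<sigma> \<Longrightarrow> 0 \<le> t \<Longrightarrow> 0 \<le> yule_pmf l \<sigma> n t"
  unfolding yule_pmf_def by (intro mult_nonneg_nonneg divide_nonneg_nonneg pochhammer_nonneg) auto

lemma yule_pmf_0: "yule_pmf l \<sigma> 0 t = exp (- l * t)"
  by (simp add: yule_pmf_def)

text \<open>
  The Kolmogorov forward equation: the probability of state \<open>n + 1\<close> is fed by births from \<open>n\<close> and drained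
  by births out of \<open>n + 1\<close>. Summed over \<open>k \<le> n\<close> it telescopes to the next lemma.
\<close>
lemma yule_pmf_deriv:
  assumes "0 < \<sigma>"
  shows "((\<lambda>t. yule_pmf l \<sigma> (Suc n) t) has_real_derivative
            (l + \<sigma> * n) * yule_pmf l \<sigma> n t - (l + \<sigma> * Suc n) * yule_pmf l \<sigma> (Suc n) t) (at t)"
proof -
  define q where "q = pochhammer (l / \<sigma>) n / fact n"
  define e where "e = exp (- (\<sigma> * t))"
  have q: "pochhammer (l / \<sigma>) (Suc n) / fact (Suc n) = q * (l + \<sigma> * n) / (\<sigma> * Suc n)"
    using assms by (simp add: q_def pochhammer_Suc field_simps)
  define r where "r = q * (l + \<sigma> * n) / (\<sigma> * Suc n)"
  have r: "q * (l + \<sigma> * n) = r * (\<sigma> * Suc n)"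
    using assms by (simp add: r_def divide_simps del: of_nat_Suc)
  have eq: "yule_pmf l \<sigma> (Suc n) = (\<lambda>t. exp (- l * t) * r * (1 - exp (- \<sigma> * t)) ^ Suc n)"
    unfolding yule_pmf_def q r_def by simp
  have "((\<lambda>t. yule_pmf l \<sigma> (Suc n) t) has_real_derivative
      r * (- l * exp (- l * t) * (1 - e) ^ Suc n
        + exp (- l * t) * (Suc n * (1 - e) ^ n * (\<sigma> * e)))) (at t)"
    unfolding eq e_def by (auto intro!: derivative_eq_intros simp: algebra_simps simp del: power_Suc of_nat_Suc)
  also have "r * (- l * exp (- l * t) * (1 - e) ^ Suc n
        + exp (- l * t) * (Suc n * (1 - e) ^ n * (\<sigma> * e)))
     = exp (- l * t) * (1 - e) ^ n * (r * (\<sigma> * Suc n))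
       - (l + \<sigma> * Suc n) * (exp (- l * t) * r * (1 - e) ^ Suc n)"
    by (simp add: algebra_simps)
  also have "exp (- l * t) * (1 - e) ^ n * (r * (\<sigma> * Suc n)) = (l + \<sigma> * n) * (exp (- l * t) * q * (1 - e) ^ n)"
    by (subst r[symmetric]) (simp only: mult_ac)
  finally show ?thesis
    unfolding yule_pmf_def[of l \<sigma> n] eq by (simp add: q_def e_def)
qed

lemma yule_tail_deriv:
  assumes "0 < \<sigma>"
  shows "((\<lambda>t. \<Sum>k\<le>n. yule_pmf l \<sigma> k t) has_real_derivative - ((l + \<sigma> * n) * yule_pmf l \<sigma> n t)) (at t)"
proof (induction n)
  case 0
  show ?case by (auto simp: yule_pmf_0 intro!: derivative_eq_intros)
next
  case (Suc n)
  show ?case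
    using DERIV_add[OF Suc yule_pmf_deriv[OF assms, of l n t]] by (simp add: algebra_simps)
qed

lemma yule_pmf_measurable [measurable]: "yule_pmf l \<sigma> n \<in> borel_measurable borel"
  unfolding yule_pmf_def by measurable

text \<open>
  The density of the time of birth \<open>n + 1\<close> is the rate \<open>l + \<sigma> * n\<close> times the probability of sitting in
  state \<open>n\<close>. Convolution with the next exponential waiting time keeps this form: after the exponentials
  are collected, the integrand is a constant times
  \<open>exp (\<sigma> * y) * (exp (\<sigma> * y) - 1) ^ n\<close>, which has an elementary primitive.
\<close>
lemma yule_convolution:
  fixes l \<sigma> x :: real
  assumes l: "0 < l" and \<sigma>: "0 < \<sigma>" and x: "0 \<le> x"
  shows "(\<integral>\<^sup>+y. ennreal (exponential_density (l + \<sigma> * Suc n) (x - y)) *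
              ennreal (if 0 \<le> y then (l + \<sigma> * n) * yule_pmf l \<sigma> n y else 0) \<partial>lborel) =
         ennreal ((l + \<sigma> * Suc n) * yule_pmf l \<sigma> (Suc n) x)"
proof -
  define q where "q = pochhammer (l / \<sigma>) n / fact n"
  have q0: "q \<ge> 0" unfolding q_def using l \<sigma> by (intro divide_nonneg_nonneg pochhammer_nonneg) auto
  define L where "L = l + \<sigma> * Suc n"
  have L: "L > 0" using l \<sigma> by (simp add: L_def add_pos_pos)
  define K where "K = exp (- L * x) * L * (l + \<sigma> * n) * q"
  have q: "pochhammer (l / \<sigma>) (Suc n) / fact (Suc n) = q * (l + \<sigma> * n) / (\<sigma> * Suc n)"
    using assms by (simp add: q_def pochhammer_Suc field_simps)
  have K0: "K \<ge> 0" unfolding K_def using l \<sigma> L q0 by simp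
  have ee: "exp (\<sigma> * y) * (exp (\<sigma> * y) - 1) ^ n = exp (\<sigma> * Suc n * y) * (1 - exp (- \<sigma> * y)) ^ n" for y :: real and n
  proof -
    have "exp (\<sigma> * y) * (1 - exp (- \<sigma> * y)) = exp (\<sigma> * y) - 1"
      by (simp add: algebra_simps flip: exp_add)
    then have "(exp (\<sigma> * y) - 1) ^ n = exp (\<sigma> * y) ^ n * (1 - exp (- \<sigma> * y)) ^ n"
      by (metis power_mult_distrib)
    then show ?thesis by (simp add: algebra_simps flip: exp_of_nat_mult exp_add)
  qed
  have "(\<integral>\<^sup>+y. ennreal (exponential_density L (x - y)) *
              ennreal (if 0 \<le> y then (l + \<sigma> * n) * yule_pmf l \<sigma> n y else 0) \<partial>lborel)
      = (\<integral>\<^sup>+y. ennreal (K * (exp (\<sigma> * y) * (exp (\<sigma> * y) - 1) ^ n)) * indicator {0..x} y \<partial>lborel)"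
  proof (intro nn_integral_cong)
    fix y
    show "ennreal (exponential_density L (x - y)) *
              ennreal (if 0 \<le> y then (l + \<sigma> * n) * yule_pmf l \<sigma> n y else 0)
       = ennreal (K * (exp (\<sigma> * y) * (exp (\<sigma> * y) - 1) ^ n)) * indicator {0..x} y"
    proof (cases "y \<in> {0..x}")
      case True
      have "exponential_density L (x - y) * ((l + \<sigma> * n) * yule_pmf l \<sigma> n y)
          = K * (exp (\<sigma> * y) * (exp (\<sigma> * y) - 1) ^ n)"
        using True unfolding ee
        by (simp add: exponential_density_def yule_pmf_def q_def[symmetric] K_def L_def)
           (simp add: algebra_simps flip: exp_add)
      then show ?thesis
        using True l \<sigma> L by (simp add: exponential_density_nonneg yule_pmf_nonneg flip: ennreal_mult)
    next
      case False
      then show ?thesis by (auto simp: exponential_density_def)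
    qed
  qed
  also have "\<dots> = ennreal (K * ((exp (\<sigma> * x) - 1) ^ Suc n / (\<sigma> * Suc n)) - K * ((exp (\<sigma> * 0) - 1) ^ Suc n / (\<sigma> * Suc n)))"
    using \<sigma> x K0
    by (intro nn_integral_FTC_Icc)
       (auto intro!: derivative_eq_intros simp: has_real_derivative_iff_has_vector_derivative[symmetric] divide_simps simp del: of_nat_Suc power_Suc)
  also have "K * ((exp (\<sigma> * x) - 1) ^ Suc n / (\<sigma> * Suc n)) - K * ((exp (\<sigma> * 0) - 1) ^ Suc n / (\<sigma> * Suc n)) =
       L * (q * (l + \<sigma> * n) / (\<sigma> * Suc n)) * (exp (- L * x) * (exp (\<sigma> * x) - 1) ^ Suc n)"
    by (simp add: K_def)
  also have "exp (- L * x) * (exp (\<sigma> * x) - 1) ^ Suc n = exp (- l * x) * (1 - exp (- \<sigma> * x)) ^ Suc n"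
  proof -
    have *: "exp (- L * x) = exp (- L * x - \<sigma> * x) * exp (\<sigma> * x)"
      by (simp flip: exp_add)
    have "exp (- L * x) * (exp (\<sigma> * x) - 1) ^ Suc n = exp (- L * x - \<sigma> * x) * (exp (\<sigma> * x) * (exp (\<sigma> * x) - 1) ^ Suc n)"
      by (simp only: * mult.assoc)
    also have "\<dots> = exp (- L * x - \<sigma> * x + \<sigma> * Suc (Suc n) * x) * (1 - exp (- \<sigma> * x)) ^ Suc n"
      unfolding ee by (simp only: exp_add mult_ac)
    also have "- L * x - \<sigma> * x + \<sigma> * Suc (Suc n) * x = - l * x" by (simp add: L_def algebra_simps)
    finally show ?thesis .
  qed
  finally show ?thesis
    unfolding yule_pmf_def q L_def by (simp add: mult_ac)
qed

text \<open>
  Half-lines \<open>{s<..}\<close> together with the whole line form an intersection-stable generator of the Borel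
  sets, so a product formula for joint tails already yields independence. Only nonnegative thresholds
  are prescribed; the case \<open>s = 0\<close> says that all variables are almost surely positive, which
  settles the negative ones.
\<close>
lemma (in prob_space) indep_exponential_of_tails:
  fixes T :: "nat \<Rightarrow> 'a \<Rightarrow> real"
  assumes T [measurable]: "\<And>k. T k \<in> borel_measurable M"
    and L: "\<And>k. 0 < L k"
    and tails: "\<And>s. \<forall>k<n. 0 \<le> s k \<Longrightarrow> prob {w \<in> space M. \<forall>k<n. s k < T k w} = (\<Prod>k<n. exp (- L k * s k))"
  shows "k < n \<Longrightarrow> distributed M lborel (T k) (exponential_density (L k))"
    and "indep_vars (\<lambda>_. borel) T {..<n}"
proof -
  have tail1: "prob {w \<in> space M. x < T k w} = exp (- L k * max 0 x)" if k: "k < n" for k x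
  proof -
    have pos: "AE w in M. \<forall>k<n. 0 < T k w"
      using tails[of "\<lambda>_. 0"] by (subst prob_Collect_eq_1[symmetric]) auto
    have "prob {w \<in> space M. x < T k w} = prob {w \<in> space M. \<forall>j<n. (if j = k then max 0 x else 0) < T j w}"
      using pos k by (intro finite_measure_eq_AE) (auto split: if_splits)
    also have "\<dots> = (\<Prod>j<n. exp (- L j * (if j = k then max 0 x else 0)))"
      by (intro tails) auto
    also have "\<dots> = (\<Prod>j<n. if j = k then exp (- L k * max 0 x) else 1)"
      by (intro prod.cong) auto
    finally show ?thesis using k by simp
  qed
  show "distributed M lborel (T k) (exponential_density (L k))" if k: "k < n"
    unfolding exponential_distributed_iff[OF L]
  proof (intro conjI allI impI)
    fix x :: real assume x: "0 \<le> x"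
    have "prob {w \<in> space M. T k w \<le> x} = prob (space M - {w \<in> space M. x < T k w})"
      by (intro arg_cong[where f=prob]) auto
    also have "\<dots> = 1 - exp (- L k * x)"
      using tail1[OF k, of x] x by (subst prob_compl) auto
    finally show "prob {w \<in> space M. T k w \<le> x} = 1 - exp (- x * L k)" by (simp add: mult.commute)
  qed simp
  show "indep_vars (\<lambda>_. borel) T {..<n}"
  proof (cases "n = 0")
    case True
    then show ?thesis by (simp add: indep_vars_def indep_sets_def)
  next
    case False
    define E :: "real set set" where "E = insert UNIV (range greaterThan)"
    have pos: "AE w in M. \<forall>k<n. 0 < T k w"
      using tails[of "\<lambda>_. 0"] by (subst prob_Collect_eq_1[symmetric]) auto
    have sb: "sets borel = sigma_sets (space borel) E"
    proof -
      have "sigma_sets UNIV E = sigma_sets UNIV (range greaterThan)"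
        unfolding E_def by (intro sigma_sets_eqI) (auto intro: sigma_sets_top)
      moreover have "sets borel = sigma_sets UNIV (range (greaterThan :: real \<Rightarrow> _))"
        by (subst borel_Ioi) simp
      ultimately show ?thesis
        by simp
    qed
    have Int_greaterThan: "{x<..} \<inter> {y<..} = {max x y<..}" for x y :: real by auto
    have "Int_stable E"
      unfolding Int_stable_def E_def by (auto simp: Int_greaterThan)
    then have "indep_vars (\<lambda>_. borel) T {..<n} \<longleftrightarrow>
       (\<forall>A\<in>({..<n} \<rightarrow> E). prob (\<Inter>j\<in>{..<n}. T j -` A j \<inter> space M) = (\<Prod>j<n. prob (T j -` A j \<inter> space M)))"
      using False sb by (intro indep_vars_finite) (auto simp: E_def)
    moreover have "prob (\<Inter>j\<in>{..<n}. T j -` A j \<inter> space M) = (\<Prod>j<n. prob (T j -` A j \<inter> space M))"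
      if A: "A \<in> {..<n} \<rightarrow> E" for A
    proof -
      \<comment> \<open>The whole line imposes no condition; threshold \<open>0\<close> encodes it up to a null set.\<close>
      have "\<exists>s. \<forall>j<n. A j = UNIV \<and> s j = 0 \<or> A j = {s j<..}"
        using A unfolding E_def by (intro choice) (auto simp: Pi_iff)
      then obtain s where s: "\<And>j. j < n \<Longrightarrow> A j = UNIV \<and> s j = 0 \<or> A j = {s j<..}" by blast
      have "prob (\<Inter>j\<in>{..<n}. T j -` A j \<inter> space M) = prob {w \<in> space M. \<forall>k<n. max 0 (s k) < T k w}"
      proof (intro finite_measure_eq_AE)
        show "AE x in M. (x \<in> (\<Inter>j\<in>{..<n}. T j -` A j \<inter> space M)) = (x \<in> {w \<in> space M. \<forall>k<n. max 0 (s k) < T k w})"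
          using pos
        proof eventually_elim
          case (elim w)
          have "T j w \<in> A j \<longleftrightarrow> s j < T j w" if "j < n" for j
            using s[OF that] elim that by auto
          then show ?case using elim False by auto
        qed
        show "(\<Inter>j\<in>{..<n}. T j -` A j \<inter> space M) \<in> events"
          using False s by (intro sets.finite_INT measurable_sets[OF T]) fastforce+
      qed auto
      also have "\<dots> = (\<Prod>j<n. exp (- L j * max 0 (s j)))"
        by (intro tails) auto
      also have "\<dots> = (\<Prod>j<n. prob (T j -` A j \<inter> space M))"
      proof (intro prod.cong refl)
        fix j assume j: "j \<in> {..<n}"
        show "exp (- L j * max 0 (s j)) = prob (T j -` A j \<inter> space M)"
        proof (cases "A j = UNIV \<and> s j = 0")
          case True
          then show ?thesis by (simp add: prob_space)
        next
          case False
          then have "T j -` A j \<inter> space M = {w \<in> space M. s j < T j w}" using s[of j] j by auto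
          then show ?thesis using tail1[of j "s j"] j by simp
        qed
      qed
      finally show ?thesis .
    qed
    ultimately show ?thesis by simp
  qed
qed

text \<open>
  The event that exactly \<open>n\<close> of the waiting times have elapsed at time \<open>t\<close> is, up to a null set, the difference of the
  events that the sums of \<open>n + 1\<close> and of \<open>n\<close> waiting times exceed \<open>t\<close>. The density of each sum
  comes from \<open>yule_convolution\<close> by induction, its tail from \<open>yule_tail_deriv\<close>.
\<close>
lemma (in prob_space) yule_counting_law:
  fixes T :: "nat \<Rightarrow> 'a \<Rightarrow> real" and l \<sigma> t :: real
  assumes T [measurable]: "\<And>k. T k \<in> borel_measurable M"
    and l: "0 < l" and \<sigma>: "0 < \<sigma>" and t: "0 \<le> t"
    and tails: "\<And>s. \<forall>k\<le>n. 0 \<le> s k \<Longrightarrow>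
      prob {w \<in> space M. \<forall>k\<le>n. s k < T k w} = (\<Prod>k\<le>n. exp (- (l + \<sigma> * real k) * s k))"
  shows "prob {w \<in> space M. (\<Sum>k<n. T k w) \<le> t \<and> t < (\<Sum>k<Suc n. T k w)} = yule_pmf l \<sigma> n t"
proof -
  have L: "0 < l + \<sigma> * k" for k :: nat using l \<sigma> by (simp add: add_pos_nonneg)
  have tails': "\<forall>k<Suc n. 0 \<le> s k \<Longrightarrow>
      prob {w \<in> space M. \<forall>k<Suc n. s k < T k w} = (\<Prod>k<Suc n. exp (- (l + \<sigma> * real k) * s k))" for s
    using tails[of s] by (simp only: less_Suc_eq_le lessThan_Suc_atMost)
  note ex = indep_exponential_of_tails[where L="\<lambda>k. l + \<sigma> * real k" and T=T and n="Suc n", OF T L tails', simplified mult_minus_left]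
  have dens: "distributed M lborel (\<lambda>w. \<Sum>k<Suc j. T k w)
      (\<lambda>y. ennreal (if 0 \<le> y then (l + \<sigma> * j) * yule_pmf l \<sigma> j y else 0))" if "j \<le> n" for j
    using that
  proof (induction j)
    case 0
    have *: "(\<lambda>y. ennreal (if 0 \<le> y then (l + \<sigma> * real 0) * yule_pmf l \<sigma> 0 y else 0)) =
        (\<lambda>y. ennreal (exponential_density (l + \<sigma> * real 0) y))"
      by (auto simp: exponential_density_def yule_pmf_0 fun_eq_iff mult.commute)
    have T0: "(\<lambda>w. \<Sum>k<Suc 0. T k w) = T 0" by simp
    show ?case unfolding * T0 by (rule ex(1)) auto
  next
    case (Suc j)
    have "indep_vars (\<lambda>_. borel) T (insert (Suc j) {..<Suc j})"
      by (rule indep_vars_subset[OF ex(2)]) (use Suc.prems in auto)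
    then have "indep_var borel (T (Suc j)) borel (\<lambda>w. \<Sum>k<Suc j. T k w)"
      by (intro indep_vars_sum) auto
    from distributed_convolution[OF this ex(1) Suc.IH] Suc.prems
    have *: "distributed M lborel (\<lambda>w. T (Suc j) w + (\<Sum>k<Suc j. T k w))
       (\<lambda>x. \<integral>\<^sup>+y. ennreal (exponential_density (l + \<sigma> * Suc j) (x - y)) *
          ennreal (if 0 \<le> y then (l + \<sigma> * j) * yule_pmf l \<sigma> j y else 0) \<partial>lborel)"
      by simp
    have "(\<lambda>x. \<integral>\<^sup>+y. ennreal (exponential_density (l + \<sigma> * Suc j) (x - y)) *
          ennreal (if 0 \<le> y then (l + \<sigma> * j) * yule_pmf l \<sigma> j y else 0) \<partial>lborel)
       = (\<lambda>x. ennreal (if 0 \<le> x then (l + \<sigma> * Suc j) * yule_pmf l \<sigma> (Suc j) x else 0))" (is "?A = ?B")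
    proof
      fix x
      show "?A x = ?B x"
      proof (cases "0 \<le> x")
        case True
        then show ?thesis using yule_convolution[OF l \<sigma>] by simp
      next
        case False
        then have "?A x = (\<integral>\<^sup>+y. 0 \<partial>(lborel :: real measure))"
          by (intro nn_integral_cong) (auto simp: exponential_density_def)
        then show ?thesis using False by simp
      qed
    qed
    with * show ?case by (simp add: add.commute)
  qed
  have tail: "prob {w \<in> space M. t < (\<Sum>k<j. T k w)} = (\<Sum>k<j. yule_pmf l \<sigma> k t)" if "j \<le> Suc n" for j
  proof (cases j)
    case 0
    then show ?thesis using t by simp
  next
    case (Suc i)
    let ?G = "\<lambda>t. - (\<Sum>k\<le>i. yule_pmf l \<sigma> k t)"
    have at0: "(\<Sum>k\<le>i. yule_pmf l \<sigma> k 0) = 1"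
      by (simp add: yule_pmf_def power_0_left if_distrib cong: if_cong)
    have "emeasure M ((\<lambda>w. \<Sum>k<j. T k w) -` {..t} \<inter> space M)
       = (\<integral>\<^sup>+y. ennreal (if 0 \<le> y then (l + \<sigma> * i) * yule_pmf l \<sigma> i y else 0) * indicator {..t} y \<partial>lborel)"
      using dens[of i] Suc that by (intro distributed_emeasure) auto
    also have "\<dots> = (\<integral>\<^sup>+y. ennreal ((l + \<sigma> * i) * yule_pmf l \<sigma> i y) * indicator {0..t} y \<partial>lborel)"
      by (intro nn_integral_cong) (auto simp: indicator_def)
    also have "\<dots> = ennreal (?G t - ?G 0)"
    proof (rule nn_integral_FTC_Icc)
      fix x assume x: "x \<in> {0..t}"
      show "(?G has_real_derivative (l + \<sigma> * i) * yule_pmf l \<sigma> i x) (at x)"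
        using DERIV_minus[OF yule_tail_deriv[OF \<sigma>, of l i x]] by simp
      show "0 \<le> (l + \<sigma> * i) * yule_pmf l \<sigma> i x"
        using x l \<sigma> L[of i] by (intro mult_nonneg_nonneg yule_pmf_nonneg) auto
    qed (use t in auto)
    finally have cdf: "emeasure M ((\<lambda>w. \<Sum>k<j. T k w) -` {..t} \<inter> space M) = ennreal (1 - (\<Sum>k<j. yule_pmf l \<sigma> k t))"
      using at0 Suc by (simp add: lessThan_Suc_atMost)
    have "(\<Sum>k\<le>i. yule_pmf l \<sigma> k t) \<le> (\<Sum>k\<le>i. yule_pmf l \<sigma> k 0)"
    proof (rule DERIV_nonpos_imp_nonincreasing[OF t])
      fix x :: real assume "0 \<le> x"
      then have "- ((l + \<sigma> * i) * yule_pmf l \<sigma> i x) \<le> 0"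
        using L[of i] yule_pmf_nonneg[OF l \<sigma>, of x i] by simp
      then show "\<exists>y. ((\<lambda>t. \<Sum>k\<le>i. yule_pmf l \<sigma> k t) has_real_derivative y) (at x) \<and> y \<le> 0"
        using yule_tail_deriv[OF \<sigma>] by blast
    qed
    then have le1: "(\<Sum>k<j. yule_pmf l \<sigma> k t) \<le> 1"
      using at0 Suc by (simp add: lessThan_Suc_atMost)
    have "prob {w \<in> space M. t < (\<Sum>k<j. T k w)} = prob (space M - ((\<lambda>w. \<Sum>k<j. T k w) -` {..t} \<inter> space M))"
      by (intro arg_cong[where f=prob]) auto
    also have "\<dots> = 1 - prob ((\<lambda>w. \<Sum>k<j. T k w) -` {..t} \<inter> space M)"
      by (intro prob_compl measurable_sets[where A=borel]) auto
    also have "\<dots> = (\<Sum>k<j. yule_pmf l \<sigma> k t)"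
      using cdf le1 by (simp add: measure_def)
    finally show ?thesis .
  qed
  have pos: "AE w in M. \<forall>k\<le>n. 0 < T k w"
    using tails[of "\<lambda>_. 0"] by (subst prob_Collect_eq_1[symmetric]) auto
  have "prob {w \<in> space M. t < (\<Sum>k<Suc n. T k w)} =
     prob ({w \<in> space M. (\<Sum>k<n. T k w) \<le> t \<and> t < (\<Sum>k<Suc n. T k w)} \<union> {w \<in> space M. t < (\<Sum>k<n. T k w)})"
  proof (intro finite_measure_eq_AE)
    show "AE w in M. (w \<in> {w \<in> space M. t < (\<Sum>k<Suc n. T k w)}) =
      (w \<in> {w \<in> space M. (\<Sum>k<n. T k w) \<le> t \<and> t < (\<Sum>k<Suc n. T k w)} \<union> {w \<in> space M. t < (\<Sum>k<n. T k w)})"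
      using pos by eventually_elim (force simp: not_le)
  qed auto
  also have "\<dots> = prob {w \<in> space M. (\<Sum>k<n. T k w) \<le> t \<and> t < (\<Sum>k<Suc n. T k w)} + prob {w \<in> space M. t < (\<Sum>k<n. T k w)}"
    by (intro finite_measure_Union) auto
  finally show ?thesis using tail[of n] tail[of "Suc n"] by simp
qed

section \<open>The step operator of a balanced urn\<close>

text \<open>
  Newton's binomial series for a negative exponent, written with rising factorials; these appear
  because the total number of balls grows arithmetically.
\<close>
lemma pochhammer_binomial_sums:
  fixes w \<mu> :: real
  assumes "\<bar>w\<bar> < 1"
  shows "(\<lambda>n. pochhammer \<mu> n / fact n * w ^ n) sums (1 - w) powr (- \<mu>)"
proof -
  have "(\<lambda>n. ((- \<mu>) gchoose n) * (- w) ^ n) sums (1 + (- w)) powr (- \<mu>)"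
    by (rule gen_binomial_real) (use assms in auto)
  moreover have "((- \<mu>) gchoose n) * (- w) ^ n = pochhammer \<mu> n / fact n * w ^ n" for n
    by (simp add: gbinomial_pochhammer power_minus[of w] flip: power_add)
  ultimately show ?thesis by simp
qed

locale balanced_urn =
  fixes a b c d S :: nat
  assumes balance: "a + b = S" "c + d = S" and S_pos: "0 < S"
begin

abbreviation total :: "nat \<times> nat \<Rightarrow> nat" where
  "total z \<equiv> fst z + snd z"

text \<open>
  The generator of the urn without its killing part: the generator is \<open>h \<mapsto> step h - total * h\<close>. On monomials
  \<open>\<xi> ^ x * \<eta> ^ y\<close>, seen as functions of the exponents \<open>(x, y)\<close>, it acts as the derivation
  \<open>\<xi> ^ (a + 1) * \<eta> ^ b * \<partial>\<^sub>\<xi> + \<xi> ^ c * \<eta> ^ (d + 1) * \<partial>\<^sub>\<eta>\<close>.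
\<close>
definition step :: "(nat \<times> nat \<Rightarrow> 'v::real_vector) \<Rightarrow> nat \<times> nat \<Rightarrow> 'v" where
  "step h z = real (fst z) *\<^sub>R h (z + (a, b)) + real (snd z) *\<^sub>R h (z + (c, d))"

lemma total_add [simp]:
  "total (z + (a, b)) = total z + S" "total (z + (c, d)) = total z + S"
  using balance by auto

lemma step_pow_Suc:
  "(step ^^ Suc n) h z =
     real (fst z) *\<^sub>R (step ^^ n) h (z + (a, b)) + real (snd z) *\<^sub>R (step ^^ n) h (z + (c, d))"
  by (simp add: step_def)

lemma step_pow_add: "(step ^^ n) (\<lambda>z. h z + g z) z = (step ^^ n) h z + (step ^^ n) g z"
  by (induction n arbitrary: z) (simp_all add: step_def scaleR_add_right)

lemma step_pow_norm_le:
  fixes h :: "nat \<times> nat \<Rightarrow> 'v::real_normed_vector"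
  assumes "\<And>z. norm (h z) \<le> g z"
  shows "norm ((step ^^ n) h z) \<le> (step ^^ n) g z"
proof (induction n arbitrary: z)
  case (Suc n)
  show ?case unfolding step_pow_Suc
    by (rule norm_triangle_mono) (auto intro!: mult_left_mono Suc)
qed (use assms in simp)

text \<open>
  Both successors of a state have \<open>S\<close> more balls than the state itself, so the factors
  \<open>total z + \<mu>, total z + S + \<mu>, \<dots>\<close> collected by iteration do not depend on the colours drawn.
\<close>
lemma step_pow_supersolution:
  fixes g :: "nat \<times> nat \<Rightarrow> real"
  assumes "\<And>z. step g z \<le> (real (total z) + \<mu>) * g z" and "0 \<le> \<mu>"
  shows "(step ^^ n) g z \<le> real S ^ n * pochhammer ((real (total z) + \<mu>) / S) n * g z"
proof (induction n arbitrary: z)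
  case (Suc n)
  define P where "P = real S ^ n * pochhammer ((real (total z) + \<mu>) / S + 1) n"
  have P: "real S ^ n * pochhammer ((real (total (z + v)) + \<mu>) / S) n = P" if "v = (a, b) \<or> v = (c, d)" for v
  proof -
    have "total (z + v) = total z + S" using that total_add[of z] by blast
    then show ?thesis using S_pos by (simp add: P_def add_divide_distrib add_ac del: fst_add snd_add)
  qed
  have "P \<ge> 0"
    unfolding P_def using assms(2) by (intro mult_nonneg_nonneg pochhammer_nonneg add_nonneg_pos) auto
  have "(step ^^ Suc n) g z \<le> real (fst z) * (P * g (z + (a, b))) + real (snd z) * (P * g (z + (c, d)))"
    unfolding step_pow_Suc real_scaleR_def
    using Suc[of "z + (a, b)"] Suc[of "z + (c, d)"] P by (intro add_mono mult_left_mono) auto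
  also have "\<dots> = P * step g z" by (simp add: step_def algebra_simps)
  also have "\<dots> \<le> P * ((real (total z) + \<mu>) * g z)"
    using \<open>P \<ge> 0\<close> assms(1) by (intro mult_left_mono)
  also have "\<dots> = real S ^ Suc n * pochhammer ((real (total z) + \<mu>) / S) (Suc n) * g z"
    using S_pos by (simp add: P_def pochhammer_rec)
  finally show ?case .
qed simp

lemma step_pow_eigenfunction:
  fixes g :: "nat \<times> nat \<Rightarrow> 'v::real_vector"
  assumes "\<And>z. step g z = (real (total z) + \<mu>) *\<^sub>R g z"
  shows "(step ^^ n) g z = (real S ^ n * pochhammer ((real (total z) + \<mu>) / S) n) *\<^sub>R g z"
proof (induction n arbitrary: z)
  case (Suc n)
  define P where "P = real S ^ n * pochhammer ((real (total z) + \<mu>) / S + 1) n"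
  have P: "real S ^ n * pochhammer ((real (total (z + v)) + \<mu>) / S) n = P" if "v = (a, b) \<or> v = (c, d)" for v
  proof -
    have "total (z + v) = total z + S" using that total_add[of z] by blast
    then show ?thesis using S_pos by (simp add: P_def add_divide_distrib add_ac del: fst_add snd_add)
  qed
  have "(step ^^ Suc n) g z = P *\<^sub>R step g z"
    unfolding step_pow_Suc Suc P[OF disjI1[OF refl]] P[OF disjI2[OF refl]]
    by (simp add: step_def algebra_simps)
  also have "\<dots> = (real S ^ Suc n * pochhammer ((real (total z) + \<mu>) / S) (Suc n)) *\<^sub>R g z"
    unfolding assms using S_pos by (simp add: P_def pochhammer_rec)
  finally show ?case .
qed simp

lemma step_pow_const:
  "(step ^^ n) (\<lambda>_. v) z = (real S ^ n * pochhammer (real (total z) / S) n) *\<^sub>R v"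
  using step_pow_eigenfunction[of "\<lambda>_. v" 0] by (simp add: step_def scaleR_add_left)

text \<open>
  Leibniz' rule: in the state \<open>z + z'\<close> the drawn ball belongs either to \<open>z\<close> or to \<open>z'\<close>, and for multiplicative
  \<open>h\<close> the operator acts on one of the two factors. The binomial coefficient counts how the draws
  interleave.
\<close>
lemma step_pow_branching:
  fixes h :: "nat \<times> nat \<Rightarrow> 'v::real_algebra_1"
  assumes h: "\<And>z z'. h (z + z') = h z * h z'"
  shows "(step ^^ n) h (z + z') = (\<Sum>k\<le>n. of_nat (n choose k) * (step ^^ k) h z * (step ^^ (n - k)) h z')"
proof (induction n arbitrary: z z')
  case 0
  show ?case by (simp add: h)
next
  case (Suc n)
  define A where "A k = (step ^^ k) h z" for k
  define B where "B k = (step ^^ k) h z'" for k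
  define f where "f z z' = (\<Sum>k\<le>n. of_nat (n choose k) * (step ^^ k) h z * (step ^^ (n - k)) h z')" for z z'
  have "(step ^^ Suc n) h (z + z') =
      (real (fst z) *\<^sub>R f (z + (a, b)) z' + real (snd z) *\<^sub>R f (z + (c, d)) z') +
      (real (fst z') *\<^sub>R f z (z' + (a, b)) + real (snd z') *\<^sub>R f z (z' + (c, d)))"
    unfolding step_pow_Suc
    using Suc[of "z + (a, b)" z'] Suc[of "z + (c, d)" z'] Suc[of z "z' + (a, b)"] Suc[of z "z' + (c, d)"]
    by (simp add: f_def[symmetric] scaleR_add_left add_ac)
  also have "real (fst z) *\<^sub>R f (z + (a, b)) z' + real (snd z) *\<^sub>R f (z + (c, d)) z' =
      (\<Sum>k\<le>n. of_nat (n choose k) * A (Suc k) * B (n - k))"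
    unfolding f_def A_def B_def step_pow_Suc
    by (simp add: scaleR_sum_right algebra_simps sum.distrib)
  also have "real (fst z') *\<^sub>R f z (z' + (a, b)) + real (snd z') *\<^sub>R f z (z' + (c, d)) =
      (\<Sum>k\<le>n. of_nat (n choose k) * A k * B (Suc n - k))"
    unfolding f_def A_def B_def
    by (simp add: scaleR_sum_right sum.distrib[symmetric] Suc_diff_le step_pow_Suc algebra_simps del: funpow.simps)
  also have "(\<Sum>k\<le>n. of_nat (n choose k) * A (Suc k) * B (n - k)) + (\<Sum>k\<le>n. of_nat (n choose k) * A k * B (Suc n - k))
     = (\<Sum>k\<le>Suc n. of_nat (Suc n choose k) * A k * B (Suc n - k))"
  proof -
    have "(\<Sum>k\<le>n. of_nat (n choose k) * A k * B (Suc n - k)) = (\<Sum>k\<le>Suc n. of_nat (n choose k) * A k * B (Suc n - k))"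
      by (simp add: binomial_eq_0)
    also have "\<dots> = A 0 * B (Suc n) + (\<Sum>k\<le>n. of_nat (n choose Suc k) * A (Suc k) * B (n - k))"
      by (subst sum.atMost_Suc_shift) simp
    finally show ?thesis
      by (subst sum.atMost_Suc_shift) (simp add: algebra_simps sum.distrib)
  qed
  finally show ?case by (simp only: A_def B_def)
qed

end

section \<open>The semigroup of the urn as a power series\<close>

context balanced_urn
begin

text \<open>
  The probability of \<open>n\<close> jumps before time \<open>t\<close> from a state with \<open>l\<close> balls is this weight times the
  product of the first \<open>n\<close> jump rates; that product cancels the normalisation of the jump chain, so
  that \<open>flow h z t\<close> below is the expectation of \<open>h\<close> at time \<open>t\<close> for the urn started from \<open>z\<close>. In the
  variable \<open>1 - exp (- S * t)\<close> it is, up to \<open>exp (- total z * t)\<close>, an exponential generating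
  function.
\<close>
definition weight :: "nat \<Rightarrow> nat \<Rightarrow> real \<Rightarrow> real" where
  "weight l n t = exp (- real l * t) * (1 - exp (- real S * t)) ^ n / (fact n * real S ^ n)"

definition flow :: "(nat \<times> nat \<Rightarrow> 'v::real_normed_vector) \<Rightarrow> nat \<times> nat \<Rightarrow> real \<Rightarrow> 'v" where
  "flow h z t = (\<Sum>n. weight (total z) n t *\<^sub>R (step ^^ n) h z)"

lemma weight_nonneg: "0 \<le> t \<Longrightarrow> 0 \<le> weight l n t"
  by (simp add: weight_def)

lemma time_change_less_1: "0 \<le> t \<Longrightarrow> \<bar>1 - exp (- real S * t)\<bar> < 1"
  by (simp add: abs_less_iff add_strict_increasing)

lemma weight_mult:
  assumes "k \<le> n"
  shows "weight l k t * weight l' (n - k) t = weight (l + l') n t * real (n choose k)"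
proof -
  have pw: "x ^ n = x ^ k * x ^ (n - k)" for x :: real
    using assms by (simp flip: power_add)
  have "exp (- real (l + l') * t) = exp (- real l * t) * exp (- real l' * t)"
    by (simp add: algebra_simps flip: exp_add)
  then show ?thesis
    using assms S_pos unfolding weight_def pw[of "real S"] pw[of "1 - exp _"] binomial_fact[OF assms]
    by (simp add: mult_ac)
qed

lemma weight_sums:
  assumes t: "0 \<le> t"
  shows "(\<lambda>n. weight l n t * (real S ^ n * pochhammer ((real l + \<mu>) / S) n)) sums exp (\<mu> * t)"
proof -
  have "(\<lambda>n. exp (- real l * t) * (pochhammer ((real l + \<mu>) / S) n / fact n * (1 - exp (- real S * t)) ^ n)) sums
     (exp (- real l * t) * (1 - (1 - exp (- real S * t))) powr (- ((real l + \<mu>) / S)))"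
    by (intro sums_mult pochhammer_binomial_sums time_change_less_1 t)
  also have "exp (- real l * t) * (1 - (1 - exp (- real S * t))) powr (- ((real l + \<mu>) / S)) = exp (\<mu> * t)"
    using S_pos by (simp add: powr_def field_simps flip: exp_add)
  finally show ?thesis
    using S_pos by (simp add: weight_def field_simps)
qed

text \<open>
  If the generator applied to \<open>g\<close> is at most \<open>\<mu> * g\<close>, then \<open>g\<close> grows along the semigroup at most like
  \<open>exp (\<mu> * t)\<close>. With \<open>\<mu> = 0\<close> and constant \<open>g\<close> this is contractivity.
\<close>
lemma flow_sums_supersolution:
  fixes h :: "nat \<times> nat \<Rightarrow> 'v::banach" and g :: "nat \<times> nat \<Rightarrow> real"
  assumes t: "0 \<le> t" and hg: "\<And>z. norm (h z) \<le> g z"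
    and g: "\<And>z. step g z \<le> (real (total z) + \<mu>) * g z" and \<mu>: "0 \<le> \<mu>"
  shows "summable (\<lambda>n. norm (weight (total z) n t *\<^sub>R (step ^^ n) h z))"
    and "(\<lambda>n. weight (total z) n t *\<^sub>R (step ^^ n) h z) sums flow h z t"
    and "norm (flow h z t) \<le> exp (\<mu> * t) * g z"
proof -
  let ?B = "\<lambda>n. weight (total z) n t * (real S ^ n * pochhammer ((real (total z) + \<mu>) / S) n) * g z"
  have le: "norm (weight (total z) n t *\<^sub>R (step ^^ n) h z) \<le> ?B n" for n
  proof -
    have "norm ((step ^^ n) h z) \<le> real S ^ n * pochhammer ((real (total z) + \<mu>) / S) n * g z"
      by (rule order_trans[OF step_pow_norm_le[OF hg] step_pow_supersolution[OF g \<mu>]])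
    then show ?thesis
      using weight_nonneg[OF t] by (simp add: mult.assoc mult_left_mono)
  qed
  have B: "?B sums (exp (\<mu> * t) * g z)"
    by (intro sums_mult2 weight_sums t)
  show summ: "summable (\<lambda>n. norm (weight (total z) n t *\<^sub>R (step ^^ n) h z))"
    by (rule summable_comparison_test'[OF sums_summable[OF B], of 0]) (use le in simp)
  show "(\<lambda>n. weight (total z) n t *\<^sub>R (step ^^ n) h z) sums flow h z t"
    unfolding flow_def by (rule summable_sums[OF summable_norm_cancel[OF summ]])
  have "norm (flow h z t) \<le> (\<Sum>n. norm (weight (total z) n t *\<^sub>R (step ^^ n) h z))"
    unfolding flow_def by (rule summable_norm[OF summ])
  also have "\<dots> \<le> exp (\<mu> * t) * g z"
    using suminf_le[OF le summ sums_summable[OF B]] sums_unique[OF B] by simp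
  finally show "norm (flow h z t) \<le> exp (\<mu> * t) * g z" .
qed

lemma flow_eigenfunction:
  fixes g :: "nat \<times> nat \<Rightarrow> 'v::real_normed_vector"
  assumes t: "0 \<le> t" and g: "\<And>z. step g z = (real (total z) + \<mu>) *\<^sub>R g z"
  shows "(\<lambda>n. weight (total z) n t *\<^sub>R (step ^^ n) g z) sums (exp (\<mu> * t) *\<^sub>R g z)"
  using sums_scaleR_left[OF weight_sums[OF t, of "total z" \<mu>], of "g z"]
  unfolding step_pow_eigenfunction[of g, OF g] by simp

lemma step_const: "step (\<lambda>_. v) z = real (total z) *\<^sub>R v"
  by (simp add: step_def scaleR_add_left)

lemma flow_bounded:
  fixes h :: "nat \<times> nat \<Rightarrow> 'v::banach"
  assumes t: "0 \<le> t" and h: "\<And>z. norm (h z) \<le> K"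
  shows "summable (\<lambda>n. norm (weight (total z) n t *\<^sub>R (step ^^ n) h z))"
    and "(\<lambda>n. weight (total z) n t *\<^sub>R (step ^^ n) h z) sums flow h z t"
    and "norm (flow h z t) \<le> K"
  using flow_sums_supersolution[OF t, of h "\<lambda>_. K" 0 z] h by (simp_all add: step_const)

text \<open>
  The branching property: balls reproduce independently of each other. In terms of the series, the Cauchy product of two of these series is again such a series, by \<open>step_pow_branching\<close>.
\<close>
lemma flow_branching:
  fixes h :: "nat \<times> nat \<Rightarrow> 'v::{real_normed_algebra_1, banach, comm_ring_1}"
  assumes t: "0 \<le> t" and bounded: "\<And>z. norm (h z) \<le> K"
    and mult: "\<And>z z'. h (z + z') = h z * h z'"
  shows "flow h (z + z') t = flow h z t * flow h z' t"
proof -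
  have "flow h z t * flow h z' t =
      (\<Sum>n. \<Sum>k\<le>n. (weight (total z) k t *\<^sub>R (step ^^ k) h z) * (weight (total z') (n - k) t *\<^sub>R (step ^^ (n - k)) h z'))"
    unfolding flow_def by (intro Cauchy_product flow_bounded[OF t bounded])
  also have "\<dots> = (\<Sum>n. weight (total (z + z')) n t *\<^sub>R (step ^^ n) h (z + z'))"
  proof (intro suminf_cong)
    fix n
    have "(\<Sum>k\<le>n. (weight (total z) k t *\<^sub>R (step ^^ k) h z) * (weight (total z') (n - k) t *\<^sub>R (step ^^ (n - k)) h z'))
        = (\<Sum>k\<le>n. weight (total (z + z')) n t *\<^sub>R (of_nat (n choose k) * (step ^^ k) h z * (step ^^ (n - k)) h z'))"
    proof (intro sum.cong refl)
      fix k assume "k \<in> {..n}"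
      then have k: "k \<le> n" by simp
      have "weight (total z) k t * weight (total z') (n - k) t = weight (total (z + z')) n t * real (n choose k)"
        using weight_mult[OF k, of "total z" t "total z'"] by (simp add: add_ac)
      then have "(weight (total z) k t *\<^sub>R A) * (weight (total z') (n - k) t *\<^sub>R B) =
          weight (total (z + z')) n t *\<^sub>R (real (n choose k) *\<^sub>R (A * B))" for A B :: 'v
        by (simp only: mult_scaleR_left mult_scaleR_right scaleR_scaleR mult.commute)
      then show "(weight (total z) k t *\<^sub>R (step ^^ k) h z) * (weight (total z') (n - k) t *\<^sub>R (step ^^ (n - k)) h z')
        = weight (total (z + z')) n t *\<^sub>R (of_nat (n choose k) * (step ^^ k) h z * (step ^^ (n - k)) h z')"
        by (simp add: scaleR_conv_of_real mult.assoc)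
    qed
    then show "(\<Sum>k\<le>n. (weight (total z) k t *\<^sub>R (step ^^ k) h z) * (weight (total z') (n - k) t *\<^sub>R (step ^^ (n - k)) h z'))
        = weight (total (z + z')) n t *\<^sub>R (step ^^ n) h (z + z')"
      by (simp add: step_pow_branching[of h, OF mult] scaleR_sum_right del: fst_add snd_add)
  qed
  finally show ?thesis by (simp add: flow_def)
qed

lemma flow_power:
  fixes h :: "nat \<times> nat \<Rightarrow> 'v::{real_normed_algebra_1, banach, comm_ring_1}"
  assumes t: "0 \<le> t" and bounded: "\<And>z. norm (h z) \<le> K"
    and mult: "\<And>z z'. h (z + z') = h z * h z'" and one: "h 0 = 1"
  shows "flow h (x, y) t = flow h (1, 0) t ^ x * flow h (0, 1) t ^ y"
proof -
  note br = flow_branching[OF t bounded mult]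
  have step0: "(step ^^ n) h 0 = (if n = 0 then 1 else 0)" for n
    by (cases n) (simp_all add: one step_def)
  have z0: "flow h 0 t = 1"
    using suminf_finite[of "{0}" "\<lambda>n. weight 0 n t *\<^sub>R (step ^^ n) h 0"]
    by (simp add: flow_def step0 weight_def one)
  have x: "flow h (x, 0) t = flow h (1, 0) t ^ x" for x
  proof (induction x)
    case (Suc x)
    show ?case using br[of "(1, 0)" "(x, 0)"] Suc by simp
  qed (use z0 in \<open>simp add: zero_prod_def\<close>)
  have y: "flow h (0, y) t = flow h (0, 1) t ^ y" for y
  proof (induction y)
    case (Suc y)
    show ?case using br[of "(0, 1)" "(0, y)"] Suc by simp
  qed (use z0 in \<open>simp add: zero_prod_def\<close>)
  show ?thesis using br[of "(x, 0)" "(0, y)"] by (simp add: x[of x] y[of y])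
qed

text \<open>
  Termwise differentiation of the power series shifts its coefficients by one, and
  \<open>step_pow_Suc\<close> splits the shifted coefficient according to the first draw.
\<close>
lemma flow_backward_equation:
  fixes h :: "nat \<times> nat \<Rightarrow> complex"
  assumes t: "0 < t" and bounded: "\<And>z. norm (h z) \<le> K"
  shows "(flow h z has_vector_derivative
     real (fst z) *\<^sub>R flow h (z + (a, b)) t + real (snd z) *\<^sub>R flow h (z + (c, d)) t - real (total z) *\<^sub>R flow h z t) (at t)"
proof -
  define C where "C z n = (step ^^ n) h z / (fact n * of_nat S ^ n)" for z n
  define w where "w t = 1 - exp (- real S * t)" for t :: real
  define E where "E z v = (\<Sum>n. C z n * v ^ n)" for z and v :: complex
  have term_eq: "weight (total z) n t *\<^sub>R (step ^^ n) h z = exp (- real (total z) * t) *\<^sub>R (C z n * of_real (w t) ^ n)" for z n t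
    by (simp add: weight_def C_def w_def scaleR_conv_of_real)
  have summ: "summable (\<lambda>n. C z n * of_real (w t) ^ n)" if "0 \<le> t" for z t
  proof -
    have "summable (\<lambda>n. exp (real (total z) * t) *\<^sub>R weight (total z) n t *\<^sub>R (step ^^ n) h z)"
      by (rule summable_scaleR_right[OF sums_summable[OF flow_bounded(2)[OF that bounded]]])
    then show ?thesis unfolding term_eq by (simp flip: exp_add add: algebra_simps)
  qed
  have flow_E: "flow h z t = exp (- real (total z) * t) *\<^sub>R E z (of_real (w t))" if "0 \<le> t" for z t
    unfolding flow_def term_eq E_def by (rule suminf_scaleR_right[OF summ[OF that], symmetric])
  have diffs: "diffs (C z) n = (of_nat (fst z) * C (z + (a, b)) n + of_nat (snd z) * C (z + (c, d)) n) / of_nat S" for z n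
  proof -
    have f: "of_nat (Suc n) * (v / (fact (Suc n) * of_nat S ^ Suc n)) = v / (fact n * of_nat S ^ n) / of_nat S" for v :: complex
      using of_nat_neq_0[of n, where 'a=complex] by (simp add: mult_ac del: of_nat_Suc)
    show ?thesis
      unfolding diffs_def C_def f step_pow_Suc by (simp add: scaleR_conv_of_real add_divide_distrib)
  qed
  have pos: "0 \<le> t" using t by simp
  have w_less: "0 \<le> w t" "w t < w (t + 1)" using pos S_pos by (simp_all add: w_def)
  \<comment> \<open>A later time lies strictly further out in the disc of convergence.\<close>
  have "(E z has_field_derivative (\<Sum>n. diffs (C z) n * of_real (w t) ^ n)) (at (of_real (w t)))"
    unfolding E_def using pos w_less by (intro termdiffs_strong[OF summ[of "t + 1" z]]) simp_all
  also have "(\<Sum>n. diffs (C z) n * of_real (w t) ^ n) =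
      (of_nat (fst z) * E (z + (a, b)) (of_real (w t)) + of_nat (snd z) * E (z + (c, d)) (of_real (w t))) / of_nat S"
  proof (rule sums_unique[symmetric])
    have "(\<lambda>n. (of_nat (fst z) * (C (z + (a, b)) n * of_real (w t) ^ n) + of_nat (snd z) * (C (z + (c, d)) n * of_real (w t) ^ n)) / of_nat S)
       sums ((of_nat (fst z) * E (z + (a, b)) (of_real (w t)) + of_nat (snd z) * E (z + (c, d)) (of_real (w t))) / of_nat S)"
      unfolding E_def by (intro sums_divide sums_add sums_mult summable_sums summ pos)
    then show "(\<lambda>n. diffs (C z) n * of_real (w t) ^ n)
       sums ((of_nat (fst z) * E (z + (a, b)) (of_real (w t)) + of_nat (snd z) * E (z + (c, d)) (of_real (w t))) / of_nat S)"
      unfolding diffs by (simp add: algebra_simps add_divide_distrib)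
  qed
  finally have dE: "(E z has_field_derivative
      (of_nat (fst z) * E (z + (a, b)) (of_real (w t)) + of_nat (snd z) * E (z + (c, d)) (of_real (w t))) / of_nat S) (at (of_real (w t)))" .
  have dw: "((\<lambda>t. of_real (w t) :: complex) has_vector_derivative of_real (real S * exp (- real S * t))) (at t)"
    unfolding w_def
    by (intro has_vector_derivative_of_real) (auto intro!: derivative_eq_intros)
  have dexp: "((\<lambda>t. exp (- real (total z) * t)) has_field_derivative - real (total z) * exp (- real (total z) * t)) (at t)"
    by (auto intro!: derivative_eq_intros)
  note D = has_vector_derivative_scaleR[OF dexp field_vector_diff_chain_at[OF dw dE], unfolded o_def]
  \<comment> \<open>By balance the two successors carry the same extra factor, and the time change
    \<open>1 - exp (- S * t)\<close> has derivative \<open>S * exp (- S * t)\<close>.\<close>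
  define p where "p = exp (- real (total z) * t)"
  define e where "e = exp (- real S * t)"
  have pe: "exp (- real (total z + S) * t) = p * e"
    unfolding p_def e_def by (simp add: algebra_simps flip: exp_add)
  have "(flow h z has_vector_derivative
     p *\<^sub>R (of_real (real S * e) *
      ((of_nat (fst z) * E (z + (a, b)) (of_real (w t)) + of_nat (snd z) * E (z + (c, d)) (of_real (w t))) / of_nat S)) +
     (- real (total z) * p) *\<^sub>R E z (of_real (w t))) (at t)"
    unfolding p_def e_def
    by (rule has_vector_derivative_transform_within_open[OF D, of "{0<..}"]) (use t in \<open>auto simp: flow_E\<close>)
  moreover have "p *\<^sub>R (of_real (real S * e) * ((of_nat (fst z) * A + of_nat (snd z) * B) / of_nat S)) + (- real (total z) * p) *\<^sub>R C =
      real (fst z) *\<^sub>R ((p * e) *\<^sub>R A) + real (snd z) *\<^sub>R ((p * e) *\<^sub>R B) - real (total z) *\<^sub>R (p *\<^sub>R C)"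
    for A B C :: complex
    using S_pos by (simp add: scaleR_conv_of_real) (simp add: algebra_simps)
  ultimately show ?thesis
    unfolding flow_E[OF pos] total_add pe p_def[symmetric] by simp
qed

end

section \<open>The first two moments of a large urn\<close>

locale large_balanced_urn = balanced_urn +
  fixes m :: nat
  assumes eigenvalue: "a = c + m" "d = b + m" and large: "S < 2 * m"
begin

lemma u2_add: "u2 S b c (z + z') = u2 S b c z + u2 S b c z'"
  by (simp add: u2_def split_beta algebra_simps diff_divide_distrib add_divide_distrib)

lemma u2_increments: "u2 S b c (a, b) = real (b * m) / S" "u2 S b c (c, d) = - (real (c * m) / S)"
  using S_pos by (simp_all add: u2_def eigenvalue divide_simps algebra_simps)

text \<open>
  The linear form \<open>u2\<close> composed with the replacement matrix is \<open>m * u2\<close>, hence \<open>u2\<close> is an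
  eigenfunction of the generator: its expectation is multiplied by \<open>exp (m * t)\<close>.
\<close>
lemma step_u2: "step (u2 S b c) z = (real (total z) + m) *\<^sub>R u2 S b c z"
proof -
  have "step (u2 S b c) z = real (total z) * u2 S b c z
      + (real (fst z) * (real (b * m) / S) - real (snd z) * (real (c * m) / S))"
    by (simp add: step_def u2_add u2_increments algebra_simps)
  also have "real (fst z) * (real (b * m) / S) - real (snd z) * (real (c * m) / S) = m * u2 S b c z"
    by (simp add: u2_def split_beta divide_simps algebra_simps)
  finally show ?thesis by (simp add: algebra_simps)
qed

text \<open>
  A Lyapunov function for the second moment. The generator maps \<open>u2\<^sup>2\<close> to \<open>2 * m * u2\<^sup>2\<close> plus a term of
  size at most \<open>m\<^sup>2 * total\<close>, and \<open>total\<close> only grows at rate \<open>S\<close>, which is smaller than \<open>2 * m\<close>. Adding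
  the multiple \<open>m\<^sup>2\<close> of \<open>total\<close> therefore absorbs the extra term, because \<open>2 * m - S\<close> is at least \<open>1\<close>.
\<close>
definition dominating :: "nat \<times> nat \<Rightarrow> real" where
  "dominating z = (u2 S b c z)\<^sup>2 + (real m)\<^sup>2 * total z"

lemma step_dominating: "step dominating z \<le> (real (total z) + 2 * m) * dominating z"
proof -
  define p where "p = u2 S b c (a, b)"
  define q where "q = u2 S b c (c, d)"
  define u where "u = u2 S b c z"
  define x where "x = real (fst z)"
  define y where "y = real (snd z)"
  have "x * (u + p) + y * (u + q) = (x + y + m) * u"
    using step_u2[of z] by (simp add: step_def u2_add p_def q_def u_def x_def y_def)
  then have drift: "x * p + y * q = m * u" by (simp add: algebra_simps)
  have S: "real b \<le> S" "real c \<le> S" using balance by auto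
  have pq: "p\<^sup>2 \<le> (real m)\<^sup>2" "q\<^sup>2 \<le> (real m)\<^sup>2"
    using S S_pos mult_right_mono[OF S(1), of "real m"] mult_right_mono[OF S(2), of "real m"]
    by (auto simp: p_def q_def u2_increments divide_simps mult_ac intro!: power_mono simp flip: power_divide)
  have "step dominating z = x * ((u + p)\<^sup>2 + (real m)\<^sup>2 * (x + y + S)) + y * ((u + q)\<^sup>2 + (real m)\<^sup>2 * (x + y + S))"
    unfolding step_def dominating_def u2_add total_add p_def[symmetric] q_def[symmetric] u_def[symmetric]
      x_def[symmetric] y_def[symmetric]
    by (simp add: x_def y_def algebra_simps)
  also have "\<dots> = (x + y) * (u\<^sup>2 + (real m)\<^sup>2 * (x + y)) + 2 * u * (x * p + y * q)
      + (x * p\<^sup>2 + y * q\<^sup>2) + (real m)\<^sup>2 * S * (x + y)"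
    by (simp add: power2_eq_square algebra_simps)
  also have "\<dots> \<le> (x + y) * (u\<^sup>2 + (real m)\<^sup>2 * (x + y)) + 2 * u * (m * u)
      + (x * (real m)\<^sup>2 + y * (real m)\<^sup>2) + (real m)\<^sup>2 * S * (x + y)"
    unfolding drift using pq by (intro add_mono order_refl mult_left_mono) (auto simp: x_def y_def)
  also have "\<dots> = (x + y) * (u\<^sup>2 + (real m)\<^sup>2 * (x + y)) + 2 * m * u\<^sup>2 + (S + 1) * ((real m)\<^sup>2 * (x + y))"
    by (simp add: power2_eq_square algebra_simps)
  also have "\<dots> \<le> (x + y) * (u\<^sup>2 + (real m)\<^sup>2 * (x + y)) + 2 * m * u\<^sup>2 + (2 * m) * ((real m)\<^sup>2 * (x + y))"
    using large by (intro add_mono order_refl mult_right_mono) (auto simp: x_def y_def)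
  also have "\<dots> = (real (total z) + 2 * m) * dominating z"
    by (simp add: dominating_def x_def y_def u_def algebra_simps)
  finally show ?thesis .
qed

definition wave :: "real \<Rightarrow> nat \<times> nat \<Rightarrow> complex" where
  "wave \<theta> z = iexp (\<theta> * u2 S b c z)"

lemma wave_simps: "norm (wave \<theta> z) = 1" "wave \<theta> (z + z') = wave \<theta> z * wave \<theta> z'" "wave \<theta> 0 = 1"
  by (simp_all add: wave_def u2_add ring_distribs exp_add) (simp add: u2_def zero_prod_def)

text \<open>
  A second order Taylor expansion whose error, after the rescaling \<open>\<theta> = x * exp (- m * t)\<close>, is bounded
  independently of \<open>t\<close>. The remainder is dominated pointwise by a supersolution of growth rate
  \<open>2 * m\<close>; the constant and the linear term are eigenfunctions.
\<close>
lemma flow_wave_taylor: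
  assumes t: "0 \<le> t"
  shows "norm (flow (wave \<theta>) z t - (1 + \<i> * of_real (\<theta> * exp (real m * t) * u2 S b c z)))
     \<le> \<theta>\<^sup>2 / 2 * exp (2 * real m * t) * dominating z"
proof -
  let ?u = "u2 S b c"
  define r where "r z = wave \<theta> z + (- 1 + (- (\<i> * of_real \<theta>)) * of_real (?u z))" for z
  define g where "g z = \<theta>\<^sup>2 / 2 * dominating z" for z
  have rg: "norm (r z) \<le> g z" for z
  proof -
    have "norm (r z) \<le> (\<theta> * ?u z)\<^sup>2 / 2"
      using iexp_approx1[of "\<theta> * ?u z" 1] by (simp add: r_def wave_def algebra_simps power2_eq_square)
    also have "\<dots> \<le> g z"
      by (simp add: g_def dominating_def power_mult_distrib mult_left_mono)
    finally show ?thesis .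
  qed
  have g: "step g z \<le> (real (total z) + 2 * m) * g z" for z
  proof -
    have "step g z = \<theta>\<^sup>2 / 2 * step dominating z" by (simp add: step_def g_def algebra_simps)
    also have "\<dots> \<le> \<theta>\<^sup>2 / 2 * ((real (total z) + 2 * m) * dominating z)"
      by (intro mult_left_mono step_dominating) auto
    finally show ?thesis by (simp add: g_def mult_ac)
  qed
  note R = flow_sums_supersolution[OF t rg g]
  have W: "(\<lambda>n. weight (total z) n t *\<^sub>R (step ^^ n) (wave \<theta>) z) sums flow (wave \<theta>) z t"
    by (rule flow_bounded(2)[OF t, of _ 1]) (simp add: wave_simps)
  have one: "(\<lambda>n. weight (total z) n t *\<^sub>R (step ^^ n) (\<lambda>_. - 1 :: complex) z) sums - 1"
    using flow_eigenfunction[OF t, of "\<lambda>_. - 1" 0 z] by (simp add: step_const)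
  have lin: "(\<lambda>n. weight (total z) n t *\<^sub>R (step ^^ n) (\<lambda>z. - (\<i> * of_real \<theta>) * of_real (?u z)) z)
     sums (exp (real m * t) *\<^sub>R (- (\<i> * of_real \<theta>) * of_real (?u z)))"
  proof (rule flow_eigenfunction[OF t])
    fix z
    have "step (\<lambda>z. - (\<i> * of_real \<theta>) * of_real (?u z)) z = - (\<i> * of_real \<theta>) * of_real (step ?u z)"
      by (simp add: step_def scaleR_conv_of_real algebra_simps)
    then show "step (\<lambda>z. - (\<i> * of_real \<theta>) * of_real (?u z)) z =
       (real (total z) + real m) *\<^sub>R (- (\<i> * of_real \<theta>) * of_real (?u z))"
      unfolding step_u2 by (simp add: scaleR_conv_of_real)
  qed
  have "(\<lambda>n. weight (total z) n t *\<^sub>R (step ^^ n) r z) sums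
     (flow (wave \<theta>) z t + (- 1 + exp (real m * t) *\<^sub>R (- (\<i> * of_real \<theta>) * of_real (?u z))))"
    using sums_add[OF W sums_add[OF one lin]]
    by (simp only: r_def[abs_def] step_pow_add scaleR_add_right)
  with R(2)[of z] have "flow r z t = flow (wave \<theta>) z t + (- 1 + exp (real m * t) *\<^sub>R (- (\<i> * of_real \<theta>) * of_real (?u z)))"
    using sums_unique2 by auto
  with R(3)[of z] show ?thesis
    by (simp add: g_def scaleR_conv_of_real algebra_simps)
qed

end

section \<open>From rescaled limits to the differential system\<close>

text \<open>
  In the logarithmic variable \<open>s\<close> with \<open>v = x * exp (- m * s)\<close> the hypothesis exhibits
  \<open>exp (- s) * F v\<close> as a constant minus a primitive of a continuous function. So \<open>F\<close> inherits its
  derivative from the fundamental theorem of calculus. The base point \<open>x = y * exp m\<close> puts \<open>y\<close> at \<open>s = 1\<close>, in the interior of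
  the interval of integration.
\<close>
lemma ode_of_integral_equation:
  fixes F H :: "real \<Rightarrow> complex" and m :: real
  assumes m: "0 < m" and H: "continuous_on UNIV H"
    and eq: "\<And>x s. 0 \<le> s \<Longrightarrow>
      ((\<lambda>r. exp (- r) *\<^sub>R H (x * exp (- m * r))) has_integral F x - exp (- s) *\<^sub>R F (x * exp (- m * s))) {0..s}"
    and y: "y \<noteq> 0"
  shows "\<exists>D. (F has_vector_derivative D) (at y) \<and> F y + of_real (m * y) * D = H y"
proof -
  define x where "x = y * exp m"
  define k where "k r = exp (- r) *\<^sub>R H (x * exp (- m * r))" for r
  define \<phi> where "\<phi> s = F x - integral {0..s} k" for s
  define \<sigma> where "\<sigma> v = ln (x / v) / m" for v
  have x: "x \<noteq> 0" "x / y = exp m" using y by (simp_all add: x_def)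
  have \<phi>: "F (x * exp (- m * s)) = exp s *\<^sub>R \<phi> s" if "0 \<le> s" for s
    using integral_unique[OF eq[OF that, of x]] by (simp add: \<phi>_def k_def[abs_def] flip: exp_add)
  have "continuous_on {0..2} k"
    unfolding k_def by (intro continuous_intros continuous_on_compose2[OF H]) auto
  then have "((\<lambda>s. integral {0..s} k) has_vector_derivative k 1) (at 1 within {0..2})"
    by (rule integral_has_vector_derivative) auto
  then have "((\<lambda>s. integral {0..s} k) has_vector_derivative k 1) (at 1)"
    by (simp add: at_within_Icc_at)
  then have d\<phi>: "(\<phi> has_vector_derivative - k 1) (at 1)"
    unfolding \<phi>_def by (auto intro!: derivative_eq_intros)
  have "((\<lambda>s. exp s *\<^sub>R \<phi> s) has_vector_derivative exp 1 *\<^sub>R (- k 1) + exp 1 *\<^sub>R \<phi> 1) (at 1)"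
    by (rule has_vector_derivative_scaleR[OF _ d\<phi>]) (auto intro!: derivative_eq_intros)
  moreover have \<sigma>y: "\<sigma> y = 1" using x m by (simp add: \<sigma>_def)
  ultimately have d1: "((\<lambda>s. exp s *\<^sub>R \<phi> s) has_vector_derivative exp 1 *\<^sub>R (- k 1) + exp 1 *\<^sub>R \<phi> 1) (at (\<sigma> y))"
    by simp
  have d\<sigma>: "(\<sigma> has_vector_derivative - (1 / (m * y))) (at y)"
  proof -
    have "(\<sigma> has_field_derivative - (1 / (m * y))) (at y)"
      unfolding \<sigma>_def using y m x
      by (auto intro!: derivative_eq_intros simp: divide_simps power2_eq_square)
    then show ?thesis by (simp add: has_real_derivative_iff_has_vector_derivative)
  qed
  define D where "D = (- (1 / (m * y))) *\<^sub>R (exp 1 *\<^sub>R (- k 1) + exp 1 *\<^sub>R \<phi> 1)"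
  have "((\<lambda>s. exp s *\<^sub>R \<phi> s) \<circ> \<sigma> has_vector_derivative D) (at y)"
    unfolding D_def by (rule vector_diff_chain_at[OF d\<sigma> d1])
  moreover have "open ((\<lambda>v. v / x) -` {0<..<1})"
    by (intro open_vimage continuous_intros) (use x in auto)
  moreover have "y \<in> (\<lambda>v. v / x) -` {0<..<1}"
    using y m by (simp add: x_def)
  moreover have "((\<lambda>s. exp s *\<^sub>R \<phi> s) \<circ> \<sigma>) v = F v" if "v \<in> (\<lambda>v. v / x) -` {0<..<1}" for v
  proof -
    have v: "0 < v / x" "v / x < 1" using that by auto
    then have xv: "x / v > 1" "v \<noteq> 0" by (auto simp: field_simps zero_less_divide_iff divide_less_eq less_divide_eq split: if_splits)
    have "0 \<le> \<sigma> v" using xv m by (simp add: \<sigma>_def)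
    moreover have "x * exp (- m * \<sigma> v) = v"
      using xv m x by (simp add: \<sigma>_def exp_minus)
    ultimately show ?thesis using \<phi>[of "\<sigma> v"] by simp
  qed
  ultimately have "(F has_vector_derivative D) (at y)"
    using has_vector_derivative_transform_within_open by blast
  moreover have "F y + of_real (m * y) * D = H y"
  proof -
    have "x * exp (- m * 1) = y" by (simp add: x_def exp_minus)
    then have "F y = exp 1 *\<^sub>R \<phi> 1" "exp 1 *\<^sub>R k 1 = H y"
      using \<phi>[of 1] by (simp_all add: k_def flip: exp_add)
    then show ?thesis using m y by (simp add: D_def scaleR_conv_of_real algebra_simps)
  qed
  ultimately show ?thesis by blast
qed

lemma derivative_at_0_of_quadratic_bound:
  fixes F :: "real \<Rightarrow> complex"
  assumes F: "\<And>x. norm (F x - (1 + of_real x * v)) \<le> K * x\<^sup>2"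
  shows "(F has_vector_derivative v) (at 0)"
proof -
  have F0: "F 0 = 1" using F[of 0] by simp
  have "((\<lambda>x. (F (0 + x) - F 0 - x *\<^sub>R v) /\<^sub>R norm x) \<longlongrightarrow> 0) (at 0)"
  proof (rule Lim_null_comparison)
    show "\<forall>\<^sub>F x in at 0. norm ((F (0 + x) - F 0 - x *\<^sub>R v) /\<^sub>R norm x) \<le> K * \<bar>x\<bar>"
    proof (rule eventually_at_topological[THEN iffD2], intro exI[of _ UNIV] conjI ballI impI)
      fix x :: real assume x: "x \<noteq> 0"
      have "norm (F x - F 0 - x *\<^sub>R v) \<le> K * x\<^sup>2"
        using F[of x] by (simp add: F0 scaleR_conv_of_real algebra_simps)
      then show "norm ((F (0 + x) - F 0 - x *\<^sub>R v) /\<^sub>R norm x) \<le> K * \<bar>x\<bar>"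
        using x by (simp add: divide_simps abs_mult_self_eq power2_eq_square mult.assoc)
    qed auto
    show "((\<lambda>x. K * \<bar>x\<bar>) \<longlongrightarrow> 0) (at 0)"
      by (intro tendsto_mult_right_zero tendsto_rabs_zero tendsto_ident_at)
  qed
  from tendsto_norm_zero[OF this] show ?thesis
    unfolding has_vector_derivative_def has_derivative_at
    by (auto simp: bounded_linear_scaleR_left divide_inverse_commute)
qed

context large_balanced_urn
begin

text \<open>
  The backward equation \<open>f' = h - f\<close> says that \<open>exp (- r) * f (t - r)\<close> has derivative
  \<open>- exp (- r) * h (t - r)\<close> in \<open>r\<close>. It is integrated over the window \<open>[t - s, t]\<close> at frequency
  \<open>x * exp (- m * t)\<close>. Seen from time \<open>t - r\<close> this is frequency \<open>x * exp (- m * r)\<close> in the rescaled limit,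
  and since all functions are bounded by \<open>1\<close> the integral passes to the limit \<open>t \<rightarrow> \<infinity>\<close>.
\<close>
lemma limit_integral_equation:
  fixes F H :: "real \<Rightarrow> complex"
  assumes deriv: "\<And>\<theta> t. 0 < t \<Longrightarrow>
      (flow (wave \<theta>) z has_vector_derivative flow (wave \<theta>) v t - flow (wave \<theta>) z t) (at t)"
    and limF: "\<And>x. ((\<lambda>t. flow (wave (x * exp (- real m * t))) z t) \<longlongrightarrow> F x) at_top"
    and limH: "\<And>x. ((\<lambda>t. flow (wave (x * exp (- real m * t))) v t) \<longlongrightarrow> H x) at_top"
    and s: "0 \<le> s"
  shows "((\<lambda>r. exp (- r) *\<^sub>R H (x * exp (- real m * r))) has_integral
      F x - exp (- s) *\<^sub>R F (x * exp (- real m * s))) {0..s}"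
proof -
  \<comment> \<open>Times \<open>\<tau> k\<close> tend to infinity and exceed \<open>s\<close>, so that the whole window lies at positive times.\<close>
  obtain N :: nat where N: "s < real N" using reals_Archimedean2 by blast
  define \<tau> where "\<tau> k = real k + real N" for k
  define \<theta> where "\<theta> k = x * exp (- real m * \<tau> k)" for k
  have \<tau>: "s < \<tau> k" for k using N by (simp add: \<tau>_def)
  have \<theta>: "\<theta> k = (x * exp (- real m * r)) * exp (- real m * (\<tau> k - r))" for k r
    by (simp add: \<theta>_def algebra_simps flip: exp_add)
  have lim: "((\<lambda>k. flow (wave (\<theta> k)) u (\<tau> k - r)) \<longlonglongrightarrow> J (x * exp (- real m * r)))"
    if "\<And>x. ((\<lambda>t. flow (wave (x * exp (- real m * t))) u t) \<longlongrightarrow> J x) at_top" for u J r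
  proof -
    have "filterlim (\<lambda>k. (real N - r) + real k) at_top sequentially"
      by (rule filterlim_tendsto_add_at_top[OF tendsto_const filterlim_real_sequentially])
    moreover have "(\<lambda>k. (real N - r) + real k) = (\<lambda>k. \<tau> k - r)"
      by (simp add: \<tau>_def fun_eq_iff)
    ultimately have "filterlim (\<lambda>k. \<tau> k - r) at_top sequentially" by simp
    from filterlim_compose[OF that[of "x * exp (- real m * r)"] this] show ?thesis
      unfolding \<theta>[of _ r] .
  qed
  define f where "f k r = exp (- r) *\<^sub>R flow (wave (\<theta> k)) v (\<tau> k - r)" for k r
  have int: "(f k has_integral flow (wave (\<theta> k)) z (\<tau> k - 0) - exp (- s) *\<^sub>R flow (wave (\<theta> k)) z (\<tau> k - s)) {0..s}" for k
  proof -
    let ?\<phi> = "\<lambda>r. - (exp (- r) *\<^sub>R flow (wave (\<theta> k)) z (\<tau> k - r))"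
    have "(f k has_integral ?\<phi> s - ?\<phi> 0) {0..s}"
    proof (rule fundamental_theorem_of_calculus[OF s])
      fix r assume r: "r \<in> {0..s}"
      then have pos: "0 < \<tau> k - r" using \<tau>[of k] by auto
      have sh: "((\<lambda>r. \<tau> k - r) has_vector_derivative - 1) (at r)"
        by (auto intro!: derivative_eq_intros)
      have ex: "((\<lambda>r. exp (- r)) has_field_derivative - exp (- r)) (at r)"
        by (auto intro!: derivative_eq_intros)
      have "(?\<phi> has_vector_derivative f k r) (at r)"
        using has_vector_derivative_minus[OF has_vector_derivative_scaleR[OF ex vector_diff_chain_at[OF sh deriv[OF pos, of "\<theta> k"]]]]
        by (simp add: o_def f_def algebra_simps)
      then show "(?\<phi> has_vector_derivative f k r) (at r within {0..s})"
        by (rule has_vector_derivative_at_within)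
    qed
    then show ?thesis by simp
  qed
  let ?g = "\<lambda>r. exp (- r) *\<^sub>R H (x * exp (- real m * r))"
  have bound: "norm (f k r) \<le> 1" if r: "r \<in> {0..s}" for k r
  proof -
    have "norm (flow (wave (\<theta> k)) v (\<tau> k - r)) \<le> 1"
      using r \<tau>[of k] by (intro flow_bounded(3)) (auto simp: wave_simps)
    then show ?thesis using r by (auto simp: f_def intro!: mult_le_one)
  qed
  have f_int: "f k integrable_on {0..s}" for k
    using int by blast
  have one_int: "(\<lambda>_. 1 :: real) integrable_on {0..s}"
    by (rule integrable_const_ivl)
  have f_lim: "(\<lambda>k. f k r) \<longlonglongrightarrow> ?g r" if "r \<in> {0..s}" for r
    unfolding f_def by (intro tendsto_intros lim[OF limH])
  note dom = dominated_convergence[OF f_int one_int bound f_lim]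
  have "(\<lambda>k. integral {0..s} (f k)) \<longlonglongrightarrow> F (x * exp (- real m * 0)) - exp (- s) *\<^sub>R F (x * exp (- real m * s))"
    unfolding integral_unique[OF int] by (intro tendsto_intros lim[OF limF])
  with dom(2) have "integral {0..s} ?g = F x - exp (- s) *\<^sub>R F (x * exp (- real m * s))"
    using LIMSEQ_unique by fastforce
  with dom(1) show ?thesis by (simp add: has_integral_iff)
qed

text \<open>
  At frequency \<open>x * exp (- m * t)\<close> the bound of \<open>flow_wave_taylor\<close> no longer depends on \<open>t\<close>, so it passes to
  the pointwise limit.
\<close>
lemma limit_taylor:
  assumes limF: "\<And>x. ((\<lambda>t. flow (wave (x * exp (- real m * t))) z t) \<longlongrightarrow> F x) at_top"
  shows "norm (F x - (1 + of_real x * (\<i> * of_real (u2 S b c z)))) \<le> dominating z / 2 * x\<^sup>2"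
proof (rule tendsto_upperbound)
  show "((\<lambda>t. norm (flow (wave (x * exp (- real m * t))) z t - (1 + of_real x * (\<i> * of_real (u2 S b c z)))))
     \<longlongrightarrow> norm (F x - (1 + of_real x * (\<i> * of_real (u2 S b c z))))) at_top"
    by (intro tendsto_intros limF)
  show "\<forall>\<^sub>F t in at_top. norm (flow (wave (x * exp (- real m * t))) z t - (1 + of_real x * (\<i> * of_real (u2 S b c z))))
     \<le> dominating z / 2 * x\<^sup>2"
  proof (rule eventually_mono[OF eventually_ge_at_top[of 0]])
    fix t :: real assume t: "0 \<le> t"
    have 1: "x * exp (- real m * t) * exp (real m * t) = x"
      by (simp flip: exp_add)
    have "(x * exp (- real m * t))\<^sup>2 / 2 * exp (2 * real m * t) = x\<^sup>2 / 2"
    proof -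
      have "exp (2 * real m * t) = (exp (real m * t))\<^sup>2" by (simp add: exp_double[symmetric] mult_ac)
      then have "(x * exp (- real m * t))\<^sup>2 / 2 * exp (2 * real m * t) = (x * exp (- real m * t) * exp (real m * t))\<^sup>2 / 2"
        by (simp add: power_mult_distrib)
      then show ?thesis unfolding 1 .
    qed
    then show "norm (flow (wave (x * exp (- real m * t))) z t - (1 + of_real x * (\<i> * of_real (u2 S b c z)))) \<le> dominating z / 2 * x\<^sup>2"
      using flow_wave_taylor[OF t, of "x * exp (- real m * t)" z]
      unfolding 1 by (simp add: mult_ac)
  qed
qed simp

text \<open>
  Away from \<open>0\<close> the system is the differentiated integral equation. At \<open>0\<close>, where the factor \<open>x\<close> vanishes
  and the integral equation says nothing about the derivative, differentiability comes from the quadratic bound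
  of \<open>limit_taylor\<close>, and the equations reduce to \<open>1 = 1\<close>.
\<close>
lemma limit_system:
  fixes F G :: "real \<Rightarrow> complex"
  assumes limF: "\<And>x. ((\<lambda>t. flow (wave (x * exp (- real m * t))) (1, 0) t) \<longlongrightarrow> F x) at_top"
    and limG: "\<And>x. ((\<lambda>t. flow (wave (x * exp (- real m * t))) (0, 1) t) \<longlongrightarrow> G x) at_top"
    and cont: "continuous_on UNIV F" "continuous_on UNIV G"
  shows "\<exists>D. (F has_vector_derivative D) (at x) \<and> F x + of_real (real m * x) * D = F x ^ (a + 1) * G x ^ b"
    and "\<exists>D. (G has_vector_derivative D) (at x) \<and> G x + of_real (real m * x) * D = F x ^ c * G x ^ (d + 1)"
proof -
    have lim: "((\<lambda>t. flow (wave (x * exp (- real m * t))) (p, q) t) \<longlongrightarrow> F x ^ p * G x ^ q) at_top" for x p q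
  proof (rule Lim_transform_eventually)
    show "((\<lambda>t. flow (wave (x * exp (- real m * t))) (1, 0) t ^ p * flow (wave (x * exp (- real m * t))) (0, 1) t ^ q)
       \<longlongrightarrow> F x ^ p * G x ^ q) at_top"
      by (intro tendsto_intros limF limG)
    show "\<forall>\<^sub>F t in at_top. flow (wave (x * exp (- real m * t))) (1, 0) t ^ p * flow (wave (x * exp (- real m * t))) (0, 1) t ^ q
       = flow (wave (x * exp (- real m * t))) (p, q) t"
      by (rule eventually_mono[OF eventually_ge_at_top[of 0]], rule flow_power[symmetric, where K=1])
         (simp_all add: wave_simps del: plus_prod_def)
  qed
  have m: "0 < real m" using large by auto
  have at0: "F 0 = 1" "G 0 = 1" using limit_taylor[OF limF, of 0] limit_taylor[OF limG, of 0] by auto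
  have d0: "\<exists>D. (F has_vector_derivative D) (at 0)" "\<exists>D. (G has_vector_derivative D) (at 0)"
    using derivative_at_0_of_quadratic_bound[of F, OF limit_taylor[OF limF]]
      derivative_at_0_of_quadratic_bound[of G, OF limit_taylor[OF limG]] by blast+
  have backF: "(flow (wave \<theta>) (1, 0) has_vector_derivative
      flow (wave \<theta>) (a + 1, b) t - flow (wave \<theta>) (1, 0) t) (at t)" if "0 < t" for \<theta> t
    using flow_backward_equation[OF that, of "wave \<theta>" 1 "(1, 0)"] by (simp add: wave_simps)
  have backG: "(flow (wave \<theta>) (0, 1) has_vector_derivative
      flow (wave \<theta>) (c, d + 1) t - flow (wave \<theta>) (0, 1) t) (at t)" if "0 < t" for \<theta> t
    using flow_backward_equation[OF that, of "wave \<theta>" 1 "(0, 1)"] by (simp add: wave_simps)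
  show "\<exists>D. (F has_vector_derivative D) (at x) \<and> F x + of_real (real m * x) * D = F x ^ (a + 1) * G x ^ b"
  proof (cases "x = 0")
    case True
    then show ?thesis using d0(1) at0 by auto
  next
    case False
    show ?thesis
      by (rule ode_of_integral_equation[where H = "\<lambda>x. F x ^ (a + 1) * G x ^ b", OF m _ limit_integral_equation[OF backF limF lim] False])
         (auto intro!: continuous_intros cont simp del: power_Suc)
  qed
  show "\<exists>D. (G has_vector_derivative D) (at x) \<and> G x + of_real (real m * x) * D = F x ^ c * G x ^ (d + 1)"
  proof (cases "x = 0")
    case True
    then show ?thesis using d0(2) at0 by auto
  next
    case False
    show ?thesis
      by (rule ode_of_integral_equation[where H = "\<lambda>x. F x ^ c * G x ^ (d + 1)", OF m _ limit_integral_equation[OF backG limG lim] False])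
         (auto intro!: continuous_intros cont simp del: power_Suc)
  qed
qed

end

section \<open>The law of the urn process\<close>

context balanced_urn
begin

abbreviation rate :: "nat \<times> nat \<Rightarrow> nat \<times> nat \<Rightarrow> real" where
  "rate \<equiv> urn_rate a b c d"

definition successors :: "nat \<times> nat \<Rightarrow> (nat \<times> nat) set" where
  "successors z = {z + (a, b), z + (c, d)}"

lemma finite_successors [simp]: "finite (successors z)"
  by (simp add: successors_def)

lemma total_successor: "v \<in> successors z \<Longrightarrow> total v = total z + S"
  using total_add[of z] by (auto simp: successors_def)

lemma total_pos: "z \<in> urn_states \<Longrightarrow> 0 < total z"
  by (cases z) (auto simp: urn_states_def)

lemma total_pos_real: "z \<in> urn_states \<Longrightarrow> 0 < real (total z)"
  using total_pos by (simp only: of_nat_0_less_iff)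

lemma successor_in_states: "v \<in> successors z \<Longrightarrow> v \<in> urn_states"
  using total_successor[of v z] S_pos by (cases v) (auto simp: urn_states_def)

lemma rate_eq: "rate z v = (if v = z + (a, b) then real (fst z) else 0) + (if v = z + (c, d) then real (snd z) else 0)"
  by (cases z) (simp add: urn_rate_def)

lemma rate_eq_0: "v \<notin> successors z \<Longrightarrow> rate z v = 0"
  by (auto simp: rate_eq successors_def)

lemma sum_rate: "(\<Sum>v\<in>successors z. rate z v *\<^sub>R h v) = step h z"
proof -
  have "(\<Sum>v\<in>{p, q}. ((if v = p then x else 0) + (if v = q then y else 0)) *\<^sub>R h v) = x *\<^sub>R h p + y *\<^sub>R h q"
    for p q x y
    by (cases "p = q") (simp_all add: scaleR_add_left)
  then show ?thesis unfolding successors_def rate_eq step_def .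
qed

lemma sum_rate_total: "(\<Sum>v\<in>successors z. rate z v) = total z"
  using sum_rate[of z "\<lambda>_. 1 :: real"] by (simp add: step_def)

lemma exit_rate_eq: "exit_rate urn_states rate z = total z"
proof -
  have "exit_rate urn_states rate z = (\<Sum>\<^sub>\<infinity>v\<in>successors z. rate z v)"
    unfolding exit_rate_def
    by (rule infsum_cong_neutral) (auto simp: rate_eq_0 successor_in_states)
  then show ?thesis using sum_rate_total[of z] by simp
qed

end

locale urn_jump_chain = balanced_urn a b c d S + prob_space M
  for a b c d S :: nat and M :: "'p measure" +
  fixes z0 :: "nat \<times> nat" and Z :: "nat \<Rightarrow> 'p \<Rightarrow> nat \<times> nat" and T :: "nat \<Rightarrow> 'p \<Rightarrow> real"
  assumes z0_state: "z0 \<in> urn_states"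
    and Z_meas: "\<And>n. Z n \<in> M \<rightarrow>\<^sub>M count_space urn_states"
    and T_meas [measurable]: "\<And>n. T n \<in> borel_measurable M"
    and path_law: "\<And>n z s. (\<forall>k\<le>n. z k \<in> urn_states) \<Longrightarrow> (\<forall>k<n. 0 \<le> s k) \<Longrightarrow>
      prob {w \<in> space M. (\<forall>k\<le>n. Z k w = z k) \<and> (\<forall>k<n. s k < T k w)} =
        (if z 0 = z0 then 1 else 0) *
        (\<Prod>k<n. rate (z k) (z (Suc k)) / total (z k) * exp (- real (total (z k)) * s k))"
begin

lemma Z_meas' [measurable]: "Z n \<in> M \<rightarrow>\<^sub>M count_space UNIV"
  using Z_meas[of n] by (rule measurable_compose) simp

text \<open>
  Positivity of the holding times is part of the event because the path formula only speaks of strict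
  tails: the probability of this event is known directly, that of the bare path only after
  \<open>holding_times_pos\<close>.
\<close>
definition path_event :: "nat \<Rightarrow> (nat \<Rightarrow> nat \<times> nat) \<Rightarrow> 'p set" where
  "path_event j z = {w \<in> space M. (\<forall>k\<le>j. Z k w = z k) \<and> (\<forall>k<j. 0 < T k w)}"

definition path_prob :: "nat \<Rightarrow> (nat \<Rightarrow> nat \<times> nat) \<Rightarrow> real" where
  "path_prob j z = (if z 0 = z0 then 1 else 0) * (\<Prod>k<j. rate (z k) (z (Suc k)) / total (z k))"

lemma path_event_sets [measurable]: "path_event j z \<in> events"
  unfolding path_event_def by measurable

lemma prob_path_event: "\<forall>k\<le>j. z k \<in> urn_states \<Longrightarrow> prob (path_event j z) = path_prob j z"
  using path_law[of j z "\<lambda>_. 0"] by (simp add: path_event_def path_prob_def)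

lemma path_prob_nonzero:
  assumes "path_prob j z \<noteq> 0" "k \<le> j"
  shows "total (z k) = total z0 + k * S"
  using assms(2)
proof (induction k)
  case 0
  then show ?case using assms(1) by (simp add: path_prob_def split: if_splits)
next
  case (Suc k)
  have "rate (z k) (z (Suc k)) \<noteq> 0"
    using assms(1) Suc.prems by (auto simp: path_prob_def)
  then have "total (z (Suc k)) = total (z k) + S"
    using rate_eq_0 total_successor by blast
  then show ?case using Suc by simp
qed

lemma path_prob_Suc:
  "path_prob (Suc j) (z(Suc j := v)) = path_prob j z * (rate (z j) v / total (z j))"
  unfolding path_prob_def by (auto intro!: prod.cong)

text \<open>
  The events of the extended paths are disjoint, lie in the event of the path, and their
  probabilities add up to that of the path since the transition probabilities sum to \<open>1\<close>. What remains is
  a null set, which accounts at once for impossible jumps and for a nonpositive holding time.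
\<close>
lemma path_event_split:
  fixes g :: "'p \<Rightarrow> complex"
  assumes g [measurable]: "g \<in> borel_measurable M" and bounded: "\<And>w. w \<in> space M \<Longrightarrow> norm (g w) \<le> K"
    and z: "\<forall>k\<le>j. z k \<in> urn_states"
  shows "(\<integral>w. indicator (path_event j z) w *\<^sub>R g w \<partial>M) =
    (\<Sum>v\<in>successors (z j). \<integral>w. indicator (path_event (Suc j) (z(Suc j := v))) w *\<^sub>R g w \<partial>M)"
proof -
  let ?A = "\<lambda>v. path_event (Suc j) (z(Suc j := v))"
  have K: "0 \<le> K"
    using not_empty bounded order_trans[OF norm_ge_zero] by blast
  have disj: "disjoint_family_on ?A (successors (z j))"
    by (auto simp: disjoint_family_on_def path_event_def)
  have sub: "(\<Union>v\<in>successors (z j). ?A v) \<subseteq> path_event j z"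
    by (auto simp: path_event_def)
  have "prob (\<Union>v\<in>successors (z j). ?A v) = (\<Sum>v\<in>successors (z j). prob (?A v))"
    by (intro finite_measure_finite_Union disj) auto
  also have "\<dots> = (\<Sum>v\<in>successors (z j). path_prob j z * (rate (z j) v / total (z j)))"
    using z successor_in_states unfolding path_prob_Suc[symmetric]
    by (intro sum.cong prob_path_event) auto
  also have "\<dots> = path_prob j z * ((\<Sum>v\<in>successors (z j). rate (z j) v) / total (z j))"
    by (simp only: sum_distrib_left sum_divide_distrib)
  also have "\<dots> = prob (path_event j z)"
    using total_pos_real[of "z j"] z by (simp add: sum_rate_total prob_path_event)
  finally have "prob (path_event j z - (\<Union>v\<in>successors (z j). ?A v)) = 0"
    using sub by (subst finite_measure_Diff) auto
  then have ae: "AE w in M. w \<notin> path_event j z - (\<Union>v\<in>successors (z j). ?A v)"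
    by (intro AE_not_in) (auto simp: null_sets_def emeasure_eq_measure)
  have "(\<integral>w. indicator (path_event j z) w *\<^sub>R g w \<partial>M) = (\<integral>w. (\<Sum>v\<in>successors (z j). indicator (?A v) w *\<^sub>R g w) \<partial>M)"
  proof (rule integral_cong_AE)
    show "AE w in M. indicator (path_event j z) w *\<^sub>R g w = (\<Sum>v\<in>successors (z j). indicator (?A v) w *\<^sub>R g w)"
      using ae
    proof eventually_elim
      case (elim w)
      have "indicator (path_event j z) w = (indicator (\<Union>v\<in>successors (z j). ?A v) w :: real)"
        using elim sub by (auto simp: indicator_def)
      also have "\<dots> = (\<Sum>v\<in>successors (z j). indicator (?A v) w)"
        by (rule indicator_UN_disjoint[OF _ disj]) simp
      finally show ?case by (simp only: scaleR_sum_left)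
    qed
  qed measurable
  also have "\<dots> = (\<Sum>v\<in>successors (z j). \<integral>w. indicator (?A v) w *\<^sub>R g w \<partial>M)"
  proof (rule Bochner_Integration.integral_sum)
    fix v
    show "integrable M (\<lambda>w. indicator (?A v) w *\<^sub>R g w)"
      using bounded K by (intro integrable_const_bound[where B=K]) (auto simp: indicator_def)
  qed
  finally show ?thesis .
qed

text \<open>
  Backward induction along paths: an expectation is determined by its values \<open>W J z\<close> on the events of long
  paths, provided that the candidate values \<open>W j z\<close> are consistent under one more step. Extending
  paths one jump at a time replaces a sum over all paths of a given length.
\<close>
lemma integral_by_paths:
  fixes g :: "'p \<Rightarrow> complex"
  assumes g [measurable]: "g \<in> borel_measurable M" and bounded: "\<And>w. w \<in> space M \<Longrightarrow> norm (g w) \<le> K"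
    and base: "\<And>z. \<forall>k\<le>J. z k \<in> urn_states \<Longrightarrow>
      (\<integral>w. indicator (path_event J z) w *\<^sub>R g w \<partial>M) = W J z"
    and rec: "\<And>j z. j < J \<Longrightarrow> \<forall>k\<le>j. z k \<in> urn_states \<Longrightarrow>
      W j z = (\<Sum>v\<in>successors (z j). W (Suc j) (z(Suc j := v)))"
  shows "(\<integral>w. g w \<partial>M) = W 0 (\<lambda>_. z0)"
proof -
  have "(\<integral>w. indicator (path_event j z) w *\<^sub>R g w \<partial>M) = W j z" if "j \<le> J" "\<forall>k\<le>j. z k \<in> urn_states" for j z
    using that
  proof (induction j arbitrary: z rule: inc_induct)
    case base
    then show ?case by (rule assms(3))
  next
    case (step j)
    have "(\<integral>w. indicator (path_event j z) w *\<^sub>R g w \<partial>M) =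
       (\<Sum>v\<in>successors (z j). \<integral>w. indicator (path_event (Suc j) (z(Suc j := v))) w *\<^sub>R g w \<partial>M)"
      by (rule path_event_split[OF g bounded step.prems])
    also have "\<dots> = (\<Sum>v\<in>successors (z j). W (Suc j) (z(Suc j := v)))"
      by (intro sum.cong refl step.IH) (use step.prems successor_in_states in \<open>auto simp: le_Suc_eq\<close>)
    also have "\<dots> = W j z"
      using rec[of j z] step by simp
    finally show ?case .
  qed
  from this[of 0 "\<lambda>_. z0"] have "(\<integral>w. indicator (path_event 0 (\<lambda>_. z0)) w *\<^sub>R g w \<partial>M) = W 0 (\<lambda>_. z0)"
    using z0_state by simp
  moreover have "AE w in M. w \<in> path_event 0 (\<lambda>_. z0)"
    using prob_path_event[of 0 "\<lambda>_. z0"] z0_state by (intro AE_prob_1) (simp add: path_prob_def)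
  then have "(\<integral>w. indicator (path_event 0 (\<lambda>_. z0)) w *\<^sub>R g w \<partial>M) = (\<integral>w. g w \<partial>M)"
    by (intro integral_cong_AE) (auto elim!: eventually_mono)
  ultimately show ?thesis by simp
qed

text \<open>
  A long enough path event already contains the condition \<open>0 < T n\<close>, so the exceptional event has
  value \<open>0\<close> on each of them.
\<close>
lemma holding_times_pos: "AE w in M. \<forall>k. 0 < T k w"
  unfolding AE_all_countable
proof
  fix n
  let ?N = "{w \<in> space M. T n w \<le> 0}"
  have null: "indicator (path_event (Suc n) z) w *\<^sub>R complex_of_real (indicator ?N w) = 0" for z w
    by (auto simp: path_event_def indicator_def)
  have "(\<integral>w. complex_of_real (indicator ?N w) \<partial>M) = 0"
  proof (rule integral_by_paths[where J = "Suc n" and K = 1 and W = "\<lambda>_ _. 0"])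
    show "norm (complex_of_real (indicator ?N w)) \<le> 1" for w by (simp add: indicator_def)
  qed (simp_all add: null)
  then have "prob ?N = 0"
    by (simp add: integral_complex_of_real)
  then have "AE w in M. w \<notin> ?N"
    by (intro AE_not_in) (auto simp: null_sets_def emeasure_eq_measure)
  then show "AE w in M. 0 < T n w"
    by (auto elim!: eventually_mono simp: not_le AE_conjI)
qed

definition clock_event :: "nat \<Rightarrow> real \<Rightarrow> 'p set" where
  "clock_event n t = {w \<in> space M. (\<Sum>k<n. T k w) \<le> t \<and> t < (\<Sum>k<Suc n. T k w)}"

lemma clock_event_sets [measurable]: "clock_event n t \<in> events"
  unfolding clock_event_def by measurable

text \<open>
  Given a path of positive probability, the holding times are independent and exponential, and balance
  makes their parameters \<open>total z0 + S * k\<close> the same for all paths. Hence the number of jumps is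
  independent of the path and has the law of \<open>yule_counting_law\<close>.
\<close>
lemma prob_path_clock_event:
  assumes t: "0 \<le> t" and z: "\<forall>k\<le>Suc n. z k \<in> urn_states"
  shows "prob (path_event (Suc n) z \<inter> clock_event n t) = path_prob (Suc n) z * yule_pmf (total z0) S n t"
proof (cases "path_prob (Suc n) z = 0")
  case True
  have "prob (path_event (Suc n) z \<inter> clock_event n t) \<le> prob (path_event (Suc n) z)"
    by (intro finite_measure_mono) auto
  then show ?thesis using True prob_path_event[OF z] by (simp add: measure_le_0_iff)
next
  case False
  let ?A = "path_event (Suc n) z"
  let ?M' = "uniform_measure M ?A"
  have A0: "prob ?A \<noteq> 0" using False prob_path_event[OF z] by simp
  then have A: "emeasure M ?A \<noteq> 0" "emeasure M ?A \<noteq> \<infinity>" by (simp_all add: emeasure_eq_measure)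
  interpret M': prob_space ?M' by (rule prob_space_uniform_measure[OF A])
  have meas: "measure ?M' B = prob (?A \<inter> B) / prob ?A" if "B \<in> events" for B
    by (rule measure_uniform_measure[OF A that])
  have clock: "clock_event n t = {w \<in> space ?M'. (\<Sum>k<n. T k w) \<le> t \<and> t < (\<Sum>k<Suc n. T k w)}"
    by (simp add: clock_event_def)
  have "M'.prob (clock_event n t) = yule_pmf (total z0) S n t"
    unfolding clock
  proof (rule M'.yule_counting_law)
    fix s :: "nat \<Rightarrow> real" assume s: "\<forall>k\<le>n. 0 \<le> s k"
    have "?A \<inter> {w \<in> space M. \<forall>k\<le>n. s k < T k w} =
       {w \<in> space M. (\<forall>k\<le>Suc n. Z k w = z k) \<and> (\<forall>k<Suc n. s k < T k w)}"
      using s by (auto simp: path_event_def less_Suc_eq_le intro: le_less_trans)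
    moreover have "\<forall>k<Suc n. 0 \<le> s k" using s by (simp add: less_Suc_eq_le)
    note path_law[OF z this]
    ultimately have "prob (?A \<inter> {w \<in> space M. \<forall>k\<le>n. s k < T k w}) =
       path_prob (Suc n) z * (\<Prod>k<Suc n. exp (- real (total (z k)) * s k))"
      by (simp only: path_prob_def prod.distrib mult.assoc)
    moreover have "(\<Prod>k<Suc n. exp (- real (total (z k)) * s k)) = (\<Prod>k\<le>n. exp (- (real (total z0) + real S * real k) * s k))"
    proof (rule prod.cong)
      fix k assume "k \<in> {..n}"
      then have "total (z k) = total z0 + k * S" by (intro path_prob_nonzero[OF False]) auto
      then show "exp (- real (total (z k)) * s k) = exp (- (real (total z0) + real S * real k) * s k)"
        by (simp only: of_nat_add of_nat_mult mult.commute)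
    qed (auto simp: less_Suc_eq_le)
    ultimately show "M'.prob {w \<in> space ?M'. \<forall>k\<le>n. s k < T k w} = (\<Prod>k\<le>n. exp (- (real (total z0) + real S * real k) * s k))"
      using A0 prob_path_event[OF z] by (simp add: meas)
  qed (use t S_pos total_pos[OF z0_state] in auto)
  then show ?thesis
    using A0 prob_path_event[OF z] by (simp add: meas field_simps)
qed

lemma yule_pmf_eq_weight:
  "yule_pmf (total z0) S n t = weight (total z0) n t * (real S ^ n * pochhammer (real (total z0) / S) n)"
  using S_pos by (simp add: yule_pmf_def weight_def)

text \<open>
  On the event of a path with \<open>j \<le> n\<close> jumps, the conditional expectation of \<open>h (Z n)\<close> is the iterate
  \<open>(step ^^ (n - j)) h (z j)\<close> divided by the remaining jump rates.
\<close>
lemma expectation_clock_event: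
  fixes h :: "nat \<times> nat \<Rightarrow> complex"
  assumes t: "0 \<le> t" and h: "\<And>z. norm (h z) \<le> K"
  shows "(\<integral>w. indicator (clock_event n t) w *\<^sub>R h (Z n w) \<partial>M) = weight (total z0) n t *\<^sub>R (step ^^ n) h z0"
proof -
  define y where "y = yule_pmf (total z0) S n t"
  \<comment> \<open>Only \<open>j \<le> n\<close> has the meaning above; for \<open>j = n + 1\<close> the path already goes one jump past \<open>Z n\<close>.
    That jump has to be fixed because the holding time in \<open>Z n\<close> enters the clock event.\<close>
  define W where "W j z = (path_prob j z * y / (\<Prod>k\<in>{j..<n}. real (total z0) + real k * S)) *\<^sub>R (step ^^ (n - j)) h (z (min j n))" for j z
  have "(\<integral>w. indicator (clock_event n t) w *\<^sub>R h (Z n w) \<partial>M) = W 0 (\<lambda>_. z0)"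
  proof (rule integral_by_paths[where J = "Suc n" and K = K])
    show "norm (indicator (clock_event n t) w *\<^sub>R h (Z n w)) \<le> K" for w
      using h[of "Z n w"] by (auto simp: indicator_def intro: order_trans[OF norm_ge_zero])
  next
    fix z assume z: "\<forall>k\<le>Suc n. z k \<in> urn_states"
    have "(\<integral>w. indicator (path_event (Suc n) z) w *\<^sub>R (indicator (clock_event n t) w *\<^sub>R h (Z n w)) \<partial>M)
       = (\<integral>w. indicator (path_event (Suc n) z \<inter> clock_event n t) w *\<^sub>R h (z n) \<partial>M)"
      by (intro Bochner_Integration.integral_cong) (auto simp: indicator_def path_event_def)
    also have "\<dots> = prob (path_event (Suc n) z \<inter> clock_event n t) *\<^sub>R h (z n)"
      by (simp add: emeasure_eq_measure)
    also have "\<dots> = W (Suc n) z"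
      by (simp add: prob_path_clock_event[OF t z] W_def y_def)
    finally show "(\<integral>w. indicator (path_event (Suc n) z) w *\<^sub>R (indicator (clock_event n t) w *\<^sub>R h (Z n w)) \<partial>M) = W (Suc n) z" .
  next
    fix j z assume j: "j < Suc n" and z: "\<forall>k\<le>j. z k \<in> urn_states"
    show "W j z = (\<Sum>v\<in>successors (z j). W (Suc j) (z(Suc j := v)))"
    proof (cases "path_prob j z = 0")
      case True
      then show ?thesis by (simp add: W_def path_prob_Suc)
    next
      case False
      have tot: "real (total (z j)) = real (total z0) + real j * S"
        using path_prob_nonzero[OF False order_refl] by simp
      have pos: "real (total (z j)) > 0" using total_pos_real z by blast
      show ?thesis
      proof (cases "j = n")
        case True
        have "(\<Sum>v\<in>successors (z j). W (Suc j) (z(Suc j := v)))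
           = (\<Sum>v\<in>successors (z j). (path_prob j z * y / total (z j) * rate (z j) v) *\<^sub>R h (z n))"
          using True by (intro sum.cong refl) (simp add: W_def path_prob_Suc)
        also have "\<dots> = (path_prob j z * y / total (z j) * total (z j)) *\<^sub>R h (z n)"
          by (simp only: scaleR_sum_left[symmetric] sum_distrib_left[symmetric] sum_rate_total)
        finally show ?thesis using True pos by (simp add: W_def)
      next
        case False
        then have jn: "j < n" using j by simp
        define Q where "Q = (\<Prod>k\<in>{Suc j..<n}. real (total z0) + real k * S)"
        have Q: "(\<Prod>k\<in>{j..<n}. real (total z0) + real k * S) = total (z j) * Q"
          unfolding Q_def tot using jn by (rule prod.atLeast_Suc_lessThan)
        have "(\<Sum>v\<in>successors (z j). W (Suc j) (z(Suc j := v)))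
           = (\<Sum>v\<in>successors (z j). (path_prob j z * y / (total (z j) * Q)) *\<^sub>R rate (z j) v *\<^sub>R (step ^^ (n - Suc j)) h v)"
          using jn by (intro sum.cong refl) (simp add: W_def path_prob_Suc Q_def min_def)
        also have "\<dots> = (path_prob j z * y / (total (z j) * Q)) *\<^sub>R step ((step ^^ (n - Suc j)) h) (z j)"
          by (simp only: scaleR_sum_right[symmetric] sum_rate)
        also have "step ((step ^^ (n - Suc j)) h) (z j) = (step ^^ (n - j)) h (z j)"
          using jn by (metis Suc_diff_Suc comp_apply funpow.simps(2))
        finally have sum: "(\<Sum>v\<in>successors (z j). W (Suc j) (z(Suc j := v))) = (path_prob j z * y / (total (z j) * Q)) *\<^sub>R (step ^^ (n - j)) h (z j)" .
        show ?thesis unfolding sum unfolding W_def Q using jn by simp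
      qed
    qed
  qed measurable
  also have "\<dots> = weight (total z0) n t *\<^sub>R (step ^^ n) h z0"
  proof -
    define P where "P = real S ^ n * pochhammer (real (total z0) / S) n"
    have prod: "(\<Prod>k\<in>{0..<n}. real (total z0) + real k * S) = P"
      unfolding P_def using S_pos by (induction n) (simp_all add: pochhammer_Suc field_simps)
    have "P > 0"
      unfolding P_def using S_pos total_pos_real[OF z0_state]
      by (intro mult_pos_pos pochhammer_pos divide_pos_pos) auto
    then show ?thesis
      unfolding W_def y_def yule_pmf_eq_weight P_def[symmetric] prod by (simp add: path_prob_def)
  qed
  finally show ?thesis .
qed

text \<open>
  The clock events are almost surely disjoint and their probabilities sum to \<open>1\<close> by the binomial series,
  that is, the process does not explode. So the partial sums of the series miss the expectation by at
  most \<open>K\<close> times a probability that tends to \<open>0\<close>.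
\<close>
lemma expectation_eq_flow:
  fixes h :: "nat \<times> nat \<Rightarrow> complex" and U :: "real \<Rightarrow> 'p \<Rightarrow> nat \<times> nat"
  assumes t: "0 \<le> t" and h: "\<And>z. norm (h z) \<le> K"
    and U [measurable]: "U t \<in> M \<rightarrow>\<^sub>M count_space UNIV"
    and UZ: "AE w in M. \<forall>n. w \<in> clock_event n t \<longrightarrow> U t w = Z n w"
  shows "(\<integral>w. h (U t w) \<partial>M) = flow h z0 t"
proof -
  define R where "R N w = 1 - (\<Sum>n<N. indicator (clock_event n t) w :: real)" for N w
  have K: "0 \<le> K" using order_trans[OF norm_ge_zero h] .
  have intB: "integrable M (\<lambda>w. indicator (clock_event n t) w :: real)" for n
    by (intro integrable_const_bound[where B=1]) auto
  have intZ: "integrable M (\<lambda>w. indicator (clock_event n t) w *\<^sub>R h (Z n w))" for n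
    using h K by (intro integrable_const_bound[where B=K]) (auto simp: indicator_def)
  have intU: "integrable M (\<lambda>w. h (U t w))"
    using h by (intro integrable_const_bound[where B=K]) auto
  have intR: "integrable M (R N)" for N
    unfolding R_def by (intro Bochner_Integration.integrable_diff Bochner_Integration.integrable_sum intB) auto
  have clock: "(\<integral>w. indicator (clock_event n t) w *\<^sub>R h (Z n w) \<partial>M) = weight (total z0) n t *\<^sub>R (step ^^ n) h z0" for n
    by (rule expectation_clock_event[OF t h])
  have R0: "AE w in M. 0 \<le> R N w" for N
    using holding_times_pos
  proof eventually_elim
    case (elim w)
    have mono: "(\<Sum>k<i. T k w) \<le> (\<Sum>k<j. T k w)" if "i \<le> j" for i j
      using that elim by (intro sum_mono2) (auto intro: less_imp_le)
    have "\<not> (w \<in> clock_event i t \<and> w \<in> clock_event j t)" if "i < j" for i j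
      using mono[of "Suc i" j] that by (auto simp: clock_event_def)
    then have "i = j" if "w \<in> clock_event i t" "w \<in> clock_event j t" for i j
      using that by (metis linorder_neqE_nat)
    then have "card {n \<in> {..<N}. w \<in> clock_event n t} \<le> Suc 0"
      by (subst card_le_Suc0_iff_eq) auto
    moreover have "(\<Sum>n<N. indicator (clock_event n t) w) = real (card {n \<in> {..<N}. w \<in> clock_event n t})"
      by (simp add: indicator_def sum.If_cases Collect_conj_eq lessThan_def)
    ultimately show ?case by (simp add: R_def)
  qed
  have prob_clock: "(\<integral>w. indicator (clock_event n t) w \<partial>M) = weight (total z0) n t * (real S ^ n * pochhammer (real (total z0) / S) n)" for n
  proof -
    have "complex_of_real (\<integral>w. indicator (clock_event n t) w \<partial>M) = (\<integral>w. indicator (clock_event n t) w *\<^sub>R 1 \<partial>M)"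
      by (simp add: scaleR_conv_of_real)
    also have "\<dots> = weight (total z0) n t *\<^sub>R (step ^^ n) (\<lambda>_. 1) z0"
      by (rule expectation_clock_event[OF t, of "\<lambda>_. 1" 1]) simp
    finally show ?thesis
      unfolding step_pow_const by (simp add: scaleR_conv_of_real flip: of_real_mult of_real_power)
  qed
  have lim1: "(\<lambda>N. \<integral>w. R N w \<partial>M) \<longlonglongrightarrow> 0"
  proof -
    have "(\<integral>w. R N w \<partial>M) = 1 - (\<Sum>n<N. weight (total z0) n t * (real S ^ n * pochhammer (real (total z0) / S) n))" for N
      unfolding R_def prob_clock[symmetric]
      by (simp add: intB prob_space)
    moreover have "(\<lambda>N. 1 - (\<Sum>n<N. weight (total z0) n t * (real S ^ n * pochhammer (real (total z0) / S) n))) \<longlonglongrightarrow> 1 - 1"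
      using weight_sums[OF t, of "total z0" 0] unfolding sums_def by (intro tendsto_intros) simp_all
    ultimately show ?thesis by simp
  qed
  have "(\<lambda>N. \<Sum>n<N. weight (total z0) n t *\<^sub>R (step ^^ n) h z0) \<longlonglongrightarrow> (\<integral>w. h (U t w) \<partial>M)"
  proof (rule LIM_zero_cancel, rule Lim_null_comparison)
    show "(\<lambda>N. K * (\<integral>w. R N w \<partial>M)) \<longlonglongrightarrow> 0"
      by (rule tendsto_mult_right_zero[OF lim1])
    show "\<forall>\<^sub>F N in sequentially. norm ((\<Sum>n<N. weight (total z0) n t *\<^sub>R (step ^^ n) h z0) - (\<integral>w. h (U t w) \<partial>M)) \<le> K * (\<integral>w. R N w \<partial>M)"
    proof (rule always_eventually, rule allI)
      fix N
      have "(\<Sum>n<N. weight (total z0) n t *\<^sub>R (step ^^ n) h z0) - (\<integral>w. h (U t w) \<partial>M) =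
        (\<integral>w. (\<Sum>n<N. indicator (clock_event n t) w *\<^sub>R h (Z n w)) - h (U t w) \<partial>M)"
        by (simp only: Bochner_Integration.integral_diff[OF Bochner_Integration.integrable_sum[OF intZ] intU]
            Bochner_Integration.integral_sum[OF intZ] clock)
      also have "norm \<dots> \<le> (\<integral>w. norm ((\<Sum>n<N. indicator (clock_event n t) w *\<^sub>R h (Z n w)) - h (U t w)) \<partial>M)"
        by (rule integral_norm_bound)
      also have "\<dots> \<le> (\<integral>w. K * R N w \<partial>M)"
      proof (rule integral_mono_AE)
        show "AE w in M. norm ((\<Sum>n<N. indicator (clock_event n t) w *\<^sub>R h (Z n w)) - h (U t w)) \<le> K * R N w"
          using UZ R0[of N]
        proof eventually_elim
          case (elim w)
          have "(\<Sum>n<N. indicator (clock_event n t) w *\<^sub>R h (Z n w)) = (\<Sum>n<N. indicator (clock_event n t) w *\<^sub>R h (U t w))"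
            using elim by (intro sum.cong) (auto simp: indicator_def)
          then have eq: "(\<Sum>n<N. indicator (clock_event n t) w *\<^sub>R h (Z n w)) - h (U t w) = - (R N w *\<^sub>R h (U t w))"
            by (simp add: R_def scaleR_sum_left algebra_simps)
          then show ?case
            unfolding eq using mult_left_mono[OF h[of "U t w"] elim(2)] elim(2) by (simp add: mult.commute)
        qed
        show "integrable M (\<lambda>w. norm ((\<Sum>n<N. indicator (clock_event n t) w *\<^sub>R h (Z n w)) - h (U t w)))"
          by (intro integrable_norm Bochner_Integration.integrable_diff Bochner_Integration.integrable_sum intZ intU)
        show "integrable M (\<lambda>w. K * R N w)" using intR by simp
      qed
      also have "\<dots> = K * (\<integral>w. R N w \<partial>M)" by simp
      finally show "norm ((\<Sum>n<N. weight (total z0) n t *\<^sub>R (step ^^ n) h z0) - (\<integral>w. h (U t w) \<partial>M)) \<le> K * (\<integral>w. R N w \<partial>M)" .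
    qed
  qed
  moreover have "(\<lambda>N. \<Sum>n<N. weight (total z0) n t *\<^sub>R (step ^^ n) h z0) \<longlonglongrightarrow> flow h z0 t"
    using flow_bounded(2)[OF t h] unfolding sums_def .
  ultimately show ?thesis by (rule LIMSEQ_unique)
qed

end

section \<open>The characteristic functions of the limits\<close>

text \<open>
  Almost sure convergence of \<open>exp (- m * t) * u2 (U t)\<close> gives convergence of the expectations of the bounded
  functions \<open>exp (\<i> * x * _)\<close> of it, and these expectations are values of the semigroup at the shrinking frequency
  \<open>x * exp (- m * t)\<close>.
\<close>
lemma (in large_balanced_urn) flow_tendsto_char:
  fixes M :: "'p measure" and U :: "real \<Rightarrow> 'p \<Rightarrow> nat \<times> nat" and X :: "'p \<Rightarrow> real"
  assumes U: "urn_CT a b c d M z0 U" and X: "urn_limit m S b c M U X"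
  shows "((\<lambda>t. flow (wave (x * exp (- real m * t))) z0 t) \<longlongrightarrow> char (distr M borel X) x) at_top"
proof -
  note jump = U[unfolded urn_CT_def markov_jump_process_def exit_rate_eq]
  interpret prob_space M using jump by blast
  from jump obtain Z :: "nat \<Rightarrow> 'p \<Rightarrow> nat \<times> nat" and T :: "nat \<Rightarrow> 'p \<Rightarrow> real" where
    Z: "\<forall>n. Z n \<in> M \<rightarrow>\<^sub>M count_space urn_states" and T: "\<forall>n. T n \<in> borel_measurable M"
    and law: "\<forall>n z s. (\<forall>k\<le>n. z k \<in> urn_states) \<longrightarrow> (\<forall>k<n. 0 \<le> s k) \<longrightarrow>
      prob {w \<in> space M. (\<forall>k\<le>n. Z k w = z k) \<and> (\<forall>k<n. s k < T k w)} =
        (if z 0 = z0 then 1 else 0) *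
        (\<Prod>k<n. rate (z k) (z (Suc k)) / real (total (z k)) * exp (- real (total (z k)) * s k))"
    and UZ: "AE w in M. \<forall>n t. (\<Sum>k<n. T k w) \<le> t \<and> t < (\<Sum>k<Suc n. T k w) \<longrightarrow> U t w = Z n w"
    by (elim conjE exE) (rule that)
  have z0: "z0 \<in> urn_states"
    using jump by (elim conjE)
  have U_states: "\<forall>t\<ge>0. U t \<in> M \<rightarrow>\<^sub>M count_space urn_states"
    using jump by (elim conjE)
  interpret urn_jump_chain a b c d S M z0 Z T
    by unfold_locales
       (use z0 in assumption, use Z in \<open>rule spec\<close>, use T in \<open>rule spec\<close>, rule law[rule_format], blast+)
  have U_meas: "U t \<in> M \<rightarrow>\<^sub>M count_space UNIV" if "0 \<le> t" for t
    by (rule measurable_compose[OF U_states[rule_format, OF that]]) simp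
  have X_meas [measurable]: "X \<in> borel_measurable M"
    and X_lim: "AE w in M. ((\<lambda>t. exp (- real m * t) * u2 S b c (U t w)) \<longlongrightarrow> X w) at_top"
    using X by (auto simp: urn_limit_def)
  \<comment> \<open>At negative times the process is unconstrained, possibly not even measurable.\<close>
  define V where "V t = U (max 0 t)" for t
  have V [measurable]: "V t \<in> M \<rightarrow>\<^sub>M count_space UNIV" for t
    unfolding V_def by (rule U_meas) simp
  have "((\<lambda>t. \<integral>w. wave (x * exp (- real m * t)) (V t w) \<partial>M) \<longlongrightarrow> (\<integral>w. iexp (x * X w) \<partial>M)) at_top"
  proof (rule integral_dominated_convergence_at_top[where w = "\<lambda>_. 1"])
    show "AE w in M. ((\<lambda>t. wave (x * exp (- real m * t)) (V t w)) \<longlongrightarrow> iexp (x * X w)) at_top"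
      using X_lim
    proof eventually_elim
      case (elim w)
      have "((\<lambda>t. iexp (x * (exp (- real m * t) * u2 S b c (U t w)))) \<longlongrightarrow> iexp (x * X w)) at_top"
        by (intro tendsto_intros elim)
      then show ?case
        by (rule Lim_transform_eventually)
           (auto simp: wave_def V_def max_def mult.assoc intro!: eventually_mono[OF eventually_ge_at_top[of 0]])
    qed
  qed (auto simp: wave_simps)
  moreover have "(\<integral>w. wave (x * exp (- real m * t)) (V t w) \<partial>M) = flow (wave (x * exp (- real m * t))) z0 t" if "0 \<le> t" for t
  proof (rule expectation_eq_flow[OF that])
    show "AE w in M. \<forall>n. w \<in> clock_event n t \<longrightarrow> V t w = Z n w"
      using UZ by eventually_elim (use that in \<open>auto simp: clock_event_def V_def max_def\<close>)
    show "norm (wave (x * exp (- real m * t)) z) \<le> 1" for z by (simp add: wave_simps)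
  qed simp
  then have "\<forall>\<^sub>F t in at_top. (\<integral>w. wave (x * exp (- real m * t)) (V t w) \<partial>M) = flow (wave (x * exp (- real m * t))) z0 t"
    by (rule eventually_mono[OF eventually_ge_at_top[of 0]])
  ultimately have "((\<lambda>t. flow (wave (x * exp (- real m * t))) z0 t) \<longlongrightarrow> (\<integral>w. iexp (x * X w) \<partial>M)) at_top"
    by (rule Lim_transform_eventually)
  also have "(\<integral>w. iexp (x * X w) \<partial>M) = char (distr M borel X) x"
    by (simp add: char_def integral_distr)
  finally show ?thesis .
qed

lemma large_urn_imp_large_balanced_urn:
  "large_urn m S a b c d \<Longrightarrow> large_balanced_urn a b c d S m"
  unfolding large_urn_def by unfold_locales auto

lemma continuous_on_char_distr:
  assumes "prob_space M" "X \<in> borel_measurable M"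
  shows "continuous_on A (char (distr M borel X))"
proof -
  interpret real_distribution "distr M borel X"
    by (rule prob_space.real_distribution_distr[OF assms])
  show ?thesis by (intro continuous_at_imp_continuous_on ballI isCont_char)
qed

theorem proposition5p1:
  fixes m S a b c d :: nat
    and M :: "'p measure" and N :: "'q measure"
    and U :: "real \<Rightarrow> 'p \<Rightarrow> nat \<times> nat" and V :: "real \<Rightarrow> 'q \<Rightarrow> nat \<times> nat"
    and X :: "'p \<Rightarrow> real" and Y :: "'q \<Rightarrow> real"
    and F G :: "real \<Rightarrow> complex"
  assumes "large_urn m S a b c d"
    and "urn_CT a b c d M (1, 0) U" and "urn_limit m S b c M U X"
    and "urn_CT a b c d N (0, 1) V" and "urn_limit m S b c N V Y"
    and "F = char (distr M borel X)" and "G = char (distr N borel Y)"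
  shows "(\<forall>x. F differentiable (at x) \<and> G differentiable (at x) \<and>
              F x + of_nat m * of_real x * vector_derivative F (at x) = F x ^ (a + 1) * G x ^ b \<and>
              G x + of_nat m * of_real x * vector_derivative G (at x) = F x ^ c * G x ^ (d + 1)) \<and>
         (\<lambda>x. F x - (1 + \<i> * of_real (real b / real S) * of_real x)) \<in> O[at 0](\<lambda>x. of_real (x ^ 2)) \<and>
         (\<lambda>x. G x - (1 - \<i> * of_real (real c / real S) * of_real x)) \<in> O[at 0](\<lambda>x. of_real (x ^ 2))"
proof -
  interpret large_balanced_urn a b c d S m
    by (rule large_urn_imp_large_balanced_urn) fact
  have limF: "((\<lambda>t. flow (wave (x * exp (- real m * t))) (1, 0) t) \<longlongrightarrow> F x) at_top"
    and limG: "((\<lambda>t. flow (wave (x * exp (- real m * t))) (0, 1) t) \<longlongrightarrow> G x) at_top" for x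
    using flow_tendsto_char[OF assms(2,3)] flow_tendsto_char[OF assms(4,5)] assms(6,7) by simp_all
  have cont: "continuous_on UNIV F" "continuous_on UNIV G"
    using assms(2-5) unfolding assms(6,7) urn_CT_def markov_jump_process_def urn_limit_def
    by (auto intro: continuous_on_char_distr)
  have ode: "F differentiable (at x) \<and> G differentiable (at x) \<and>
      F x + of_nat m * of_real x * vector_derivative F (at x) = F x ^ (a + 1) * G x ^ b \<and>
      G x + of_nat m * of_real x * vector_derivative G (at x) = F x ^ c * G x ^ (d + 1)" for x
  proof -
    from limit_system[OF limF limG cont, of x] obtain D E where
      D: "(F has_vector_derivative D) (at x)" "F x + of_real (real m * x) * D = F x ^ (a + 1) * G x ^ b"
      and E: "(G has_vector_derivative E) (at x)" "G x + of_real (real m * x) * E = F x ^ c * G x ^ (d + 1)"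
      by blast
    show ?thesis
      using D E differentiableI_vector[OF D(1)] differentiableI_vector[OF E(1)]
      by (simp add: vector_derivative_at)
  qed
  have "norm (F x - (1 + \<i> * of_real (real b / real S) * of_real x)) \<le> dominating (1, 0) / 2 * norm (complex_of_real (x ^ 2))" for x
    using limit_taylor[OF limF, of x] by (simp add: u2_def mult_ac norm_power)
  then have F0: "(\<lambda>x. F x - (1 + \<i> * of_real (real b / real S) * of_real x)) \<in> O[at 0](\<lambda>x. complex_of_real (x ^ 2))"
    by (intro bigoI[where c = "dominating (1, 0) / 2"] always_eventually allI)
  have "norm (G x - (1 - \<i> * of_real (real c / real S) * of_real x)) \<le> dominating (0, 1) / 2 * norm (complex_of_real (x ^ 2))" for x
    using limit_taylor[OF limG, of x] by (simp add: u2_def mult_ac norm_power)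
  then have G0: "(\<lambda>x. G x - (1 - \<i> * of_real (real c / real S) * of_real x)) \<in> O[at 0](\<lambda>x. complex_of_real (x ^ 2))"
    by (intro bigoI[where c = "dominating (0, 1) / 2"] always_eventually allI)
  show ?thesis using ode F0 G0 by blast
qed

end
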